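(* Let $n\ge 1$ be an integer and $\tau\in i\mathbb{R}_+$ (i.e. $\tau/i>0$), and put $\tau_1=-4/(n\tau)$. Then the Chebyshev–Blaschke product $Y_n(\cdot|\tau)$ and the classical Zolotarëv fraction $Z_n(\cdot|\tau_1)$ differ only by pre- and post-composition with linear fractional maps; explicitly, $$Y_n(\cdot|\tau)=l^0_{n\tau}\circ Z_n(\cdot|\tau_1)\circ (l^0_{\tau})^{-1},$$ where for $\sigma\in i\mathbb{R}_+$ the linear fractional map $l^0_\sigma$ is $$l^0_\sigma(w)=-\frac{\sqrt{k}(-4/\sigma)\,w-1}{\sqrt{k}(-4/\sigma)\,w+1}.$$
   Context: For $\tau$ in the upper half-plane, elliptic functions and integrals of modulus $\tau$ are those with $\tau=iK'/K$. Here $\theta_2,\theta_3$ are the theta constants of modulus $\tau$ (nome $q=e^{i\pi\tau}$); $\sqrt{k}(\tau)=\theta_2(\tau)/\theta_3(\tau)$, which is positive for $\tau\in i\mathbb{R}_+$; $k(\tau)=(\sqrt{k}(\tau))^2$ is the Jacobi modulus; $K(\tau)=\frac{\pi}{2}\theta_3(\tau)^2$ is the complete elliptic integral of the first kind; $K'(\tau)=-i\tau K(\tau)$; and $sn(\cdot|\tau)$, $cd(\cdot|\tau)=cn(\cdot|\tau)/dn(\cdot|\tau)$ are the Jacobi elliptic functions with modulus $k(\tau)$. The classical Zolotarëv fraction of degree $n$ with $\tau\in i\mathbb{R}_+$ is the rational function $Z_n(\cdot|\tau)$ determined by $$Z_n(x_{n\tau}(u)|\tau)=x_\tau(u),\quad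 u\in\mathbb{C},\qquad x_\tau(u)=sn(K(\tau)u|\tau).$$ The Chebyshev–Blaschke product (elliptic rational function) of degree $n$ is the rational function $Y_n(\cdot|\tau)$ determined by $$Y_n(y_{1,\tau}(u)|\tau)=y_{n,\tau}(u),\quad u\in\mathbb{C},\qquad y_{n,\tau}(u)=\sqrt{k}(n\tau)\;cd(2K(n\tau)nu|n\tau).$$ *)

theory Defs
  imports "HOL-Complex_Analysis.Complex_Analysis"
    "HOL-Computational_Algebra.Computational_Algebra"
begin

text \<open>
  The Riemann sphere is rendered as \<^typ>\<open>complex option\<close>, with \<^const>\<open>None\<close> as the point at infinity.
\<close>

type_synonym sphere = "complex option"

text \<open>
  The map \<open>p/q\<close>; it is the one induced on the sphere only when \<open>p\<close> and \<open>q\<close> are coprime and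
  \<open>q \<noteq> 0\<close>.  Its value at infinity is the ratio of the coefficients of \<open>p\<close> and \<open>q\<close> in degree
  \<open>max (degree p) (degree q)\<close>.
\<close>

definition frac_map :: "complex poly \<Rightarrow> complex poly \<Rightarrow> sphere \<Rightarrow> sphere" where
  "frac_map p q w = (case w of
      Some z \<Rightarrow> (if poly q z = 0 then None else Some (poly p z / poly q z))
    | None \<Rightarrow> (let d = max (degree p) (degree q) in
                if coeff q d = 0 then None else Some (coeff p d / coeff q d)))"

definition rational_function :: "(sphere \<Rightarrow> sphere) \<Rightarrow> bool" where
  "rational_function F \<longleftrightarrow> (\<exists>p q. q \<noteq> 0 \<and> coprime p q \<and> F = frac_map p q)"

definition linear_fractional_map :: "(sphere \<Rightarrow> sphere) \<Rightarrow> bool" where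
  "linear_fractional_map F \<longleftrightarrow>
     (\<exists>a b c d. a * d - b * c \<noteq> 0 \<and> F = frac_map [:b, a:] [:d, c:])"

text \<open>
  A meromorphic function as a map to the sphere: poles go to infinity, and at every other point the
  limit is taken, so that the conventional value \<open>x / 0 = 0\<close> at a removable singularity (such as the
  common poles of cn and dn in cn/dn) plays no role.
\<close>

definition to_sphere :: "(complex \<Rightarrow> complex) \<Rightarrow> complex \<Rightarrow> sphere" where
  "to_sphere f u = (if is_pole f u then None else Some (remove_sings f u))"

text \<open>
  The nome is \<open>q = exp (\<i> * pi * \<tau>)\<close>, and \<open>q powr (a\<^sup>2)\<close> is read as \<open>exp (\<i> * pi * \<tau> * a\<^sup>2)\<close>; the quasi-periods
  in \<open>z\<close> are \<open>pi\<close> and \<open>pi * \<tau>\<close>.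
\<close>

definition theta1 :: "complex \<Rightarrow> complex \<Rightarrow> complex" where
  "theta1 z \<tau> = - \<i> * (\<Sum>\<^sub>\<infinity>m::int. (-1) powi m *
     exp (\<i> * of_real pi * \<tau> * (of_int m + 1/2)\<^sup>2 + (2 * of_int m + 1) * \<i> * z))"

definition theta2 :: "complex \<Rightarrow> complex \<Rightarrow> complex" where
  "theta2 z \<tau> = (\<Sum>\<^sub>\<infinity>m::int.
     exp (\<i> * of_real pi * \<tau> * (of_int m + 1/2)\<^sup>2 + (2 * of_int m + 1) * \<i> * z))"

definition theta3 :: "complex \<Rightarrow> complex \<Rightarrow> complex" where
  "theta3 z \<tau> = (\<Sum>\<^sub>\<infinity>m::int. exp (\<i> * of_real pi * \<tau> * (of_int m)\<^sup>2 + 2 * of_int m * \<i> * z))"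

definition theta4 :: "complex \<Rightarrow> complex \<Rightarrow> complex" where
  "theta4 z \<tau> = (\<Sum>\<^sub>\<infinity>m::int. (-1) powi m *
     exp (\<i> * of_real pi * \<tau> * (of_int m)\<^sup>2 + 2 * of_int m * \<i> * z))"

definition sqrt_k :: "complex \<Rightarrow> complex" where
  "sqrt_k \<tau> = theta2 0 \<tau> / theta3 0 \<tau>"

definition ellK :: "complex \<Rightarrow> complex" where
  "ellK \<tau> = of_real pi / 2 * (theta3 0 \<tau>)\<^sup>2"

text \<open>
  The classical theta quotients, with theta argument \<open>pi * u / (2 * K) = u / (theta3 0 \<tau>)\<^sup>2\<close>.
\<close>

definition jacobi_sn :: "complex \<Rightarrow> complex \<Rightarrow> complex" where
  "jacobi_sn u \<tau> = (let z = of_real pi * u / (2 * ellK \<tau>) in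
     theta3 0 \<tau> / theta2 0 \<tau> * (theta1 z \<tau> / theta4 z \<tau>))"

definition jacobi_cn :: "complex \<Rightarrow> complex \<Rightarrow> complex" where
  "jacobi_cn u \<tau> = (let z = of_real pi * u / (2 * ellK \<tau>) in
     theta4 0 \<tau> / theta2 0 \<tau> * (theta2 z \<tau> / theta4 z \<tau>))"

definition jacobi_dn :: "complex \<Rightarrow> complex \<Rightarrow> complex" where
  "jacobi_dn u \<tau> = (let z = of_real pi * u / (2 * ellK \<tau>) in
     theta4 0 \<tau> / theta3 0 \<tau> * (theta3 z \<tau> / theta4 z \<tau>))"

definition jacobi_cd :: "complex \<Rightarrow> complex \<Rightarrow> complex" where
  "jacobi_cd u \<tau> = jacobi_cn u \<tau> / jacobi_dn u \<tau>"

definition x_param :: "complex \<Rightarrow> complex \<Rightarrow> sphere" where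
  "x_param \<tau> = to_sphere (\<lambda>u. jacobi_sn (ellK \<tau> * u) \<tau>)"

definition y_param :: "nat \<Rightarrow> complex \<Rightarrow> complex \<Rightarrow> sphere" where
  "y_param n \<tau> = to_sphere (\<lambda>u. sqrt_k (of_nat n * \<tau>) *
     jacobi_cd (2 * ellK (of_nat n * \<tau>) * of_nat n * u) (of_nat n * \<tau>))"

definition zolotarev_fraction :: "nat \<Rightarrow> complex \<Rightarrow> sphere \<Rightarrow> sphere" where
  "zolotarev_fraction n \<tau> =
     (THE Z. rational_function Z \<and> (\<forall>u. Z (x_param (of_nat n * \<tau>) u) = x_param \<tau> u))"

definition chebyshev_blaschke :: "nat \<Rightarrow> complex \<Rightarrow> sphere \<Rightarrow> sphere" where
  "chebyshev_blaschke n \<tau> =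
     (THE Y. rational_function Y \<and> (\<forall>u. Y (y_param 1 \<tau> u) = y_param n \<tau> u))"

definition l0 :: "complex \<Rightarrow> sphere \<Rightarrow> sphere" where
  "l0 \<sigma> = frac_map (- [:-1, sqrt_k (- 4 / \<sigma>):]) [:1, sqrt_k (- 4 / \<sigma>):]"

end

theory Submission
  imports Defs "HOL-Computational_Algebra.Field_as_Ring"
begin

text \<open>
  Up to Moebius maps, both fractions express a theta quotient of modulus \<open>\<tau>\<^sub>1\<close> through the one of
  modulus \<open>n \<tau>\<^sub>1\<close>.  Existence comes from a dimension count: entire functions \<open>f\<close> with
  \<open>f (z + 2 pi) = f z = f (pi - z)\<close> and the multiplier of order \<open>n\<close> for the shift by \<open>pi T\<close> are determined by
  their Fourier coefficients with index \<open>0..n\<close>, so with \<open>T = n \<tau>\<^sub>1\<close> the functions \<open>theta1\<close>, \<open>theta4\<close>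
  of modulus \<open>\<tau>\<^sub>1\<close> are homogeneous polynomials of degree \<open>n\<close> in those of modulus \<open>T\<close>.  Uniqueness holds
  because a nonconstant theta quotient maps onto the sphere.  Finally, duplication of the nome and Jacobi's
  imaginary transformation (needed only up to a constant, since it is applied to quotients) give
  \<open>l0 \<sigma>\<close> as the map from the sn parametrisation of modulus \<open>- 4 / \<sigma>\<close> to the cd parametrisation of
  modulus \<open>\<sigma>\<close>.
\<close>

section \<open>Entire functions of period two pi\<close>

text \<open>No zero of a theta function is ever located. Zero counts and Liouville's theorem for
  elliptic functions are replaced by one bound: the symmetric space of order n has dimension at most
  n + 1, which is also the number of monomials of degree n in two generators. The case n = 0 says
  that a quotient without poles is constant. The reflection z -> pi - z is what makes the numbers
  match: without it the dimension would be 2n, and for n > 1 the monomials would not span. The theta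
  constants are nonzero by positivity of their series on the imaginary axis, directly or after the
  imaginary transformation. The moduli fit because \<sigma> -> -4/\<sigma> sends the moduli of Y_n,
  namely \<tau> and n \<tau>, to T and \<open>\<tau>\<^sub>1\<close>, those of Z_n; both fractions
  relate the same two lattices. The 4 is the square of the 2 in the splitting of a theta series by
  the parity of its index. Most identities are available only where denominators do not vanish;
  limits on the sphere extend them to all points.\<close>

lemma entire_eventually_nonzero:
  fixes G :: "complex \<Rightarrow> complex"
  assumes "G holomorphic_on UNIV" "G b \<noteq> 0"
  shows "eventually (\<lambda>z. G z \<noteq> 0) (at z0)"
  using non_zero_neighbour_alt[of G UNIV z0 b] assms by (auto elim: eventually_mono)

lemma entire_eq_if_eventually_eq:
  fixes f g :: "complex \<Rightarrow> complex"
  assumes "f holomorphic_on UNIV" "g holomorphic_on UNIV"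
    and "eventually (\<lambda>z. f z = g z) (at z0)"
  shows "f z = g z"
proof (rule ccontr)
  assume "f z \<noteq> g z"
  then have "eventually (\<lambda>z. f z - g z \<noteq> 0) (at z0)"
    using assms by (intro entire_eventually_nonzero[of _ z]) (auto intro!: holomorphic_intros)
  with assms(3) have "eventually (\<lambda>z. False) (at z0)"
    by eventually_elim simp
  then show False by simp
qed

text \<open>Entire functions form an integral domain, since zeros are isolated. This cancels a
  factor \<open>g\<close> that may itself have zeros.\<close>

lemma entire_mult_eq_0D:
  fixes f g :: "complex \<Rightarrow> complex"
  assumes "f holomorphic_on UNIV" "g holomorphic_on UNIV" "g b \<noteq> 0" "\<And>z. f z * g z = 0"
  shows "f z = 0"
proof -
  have "eventually (\<lambda>z. f z = 0) (at 0)"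
    using entire_eventually_nonzero[OF assms(2,3)] by eventually_elim (use assms(4) in auto)
  then show ?thesis
    using entire_eq_if_eventually_eq[of f "\<lambda>_. 0"] assms(1) by auto
qed

text \<open>Finite limits everywhere make all singularities of the quotient removable. With
  \<open>remove_sings\<close> the value at a zero of \<open>G\<close> is the limit, and the product
  identity holds there by continuity.\<close>

lemma entire_quotient:
  fixes F G :: "complex \<Rightarrow> complex"
  assumes F: "F holomorphic_on UNIV" and G: "G holomorphic_on UNIV" "G b \<noteq> 0"
    and lim: "\<And>z. \<exists>c. (\<lambda>w. F w / G w) \<midarrow>z\<rightarrow> c"
  obtains h where "h holomorphic_on UNIV" "\<And>z. h z * G z = F z"
proof -
  define h where "h = remove_sings (\<lambda>w. F w / G w)"
  have ana: "F analytic_on {z}" "G analytic_on {z}" for z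
    using F G by (metis analytic_on_open analytic_on_subset open_UNIV subset_UNIV)+
  have iso: "isolated_singularity_at (\<lambda>w. F w / G w) z" for z
  proof -
    have "isolated_singularity_at (\<lambda>w. F w * inverse (G w)) z"
      by (intro isolated_singularity_at_times isolated_singularity_at_inverse
          isolated_singularity_at_analytic not_essential_analytic ana)
    then show ?thesis by (simp add: field_simps)
  qed
  have h: "h holomorphic_on UNIV"
    unfolding h_def using lim iso
    by (metis analytic_imp_holomorphic analytic_on_analytic_at remove_sings_analytic_at)
  have "h z * G z = F z" for z
  proof -
    obtain c where c: "(\<lambda>w. F w / G w) \<midarrow>z\<rightarrow> c" using lim by blast
    then have hc: "h z = c" unfolding h_def by (rule remove_sings_eqI)
    have "(\<lambda>w. F w / G w * G w) \<midarrow>z\<rightarrow> c * G z"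
      by (intro tendsto_mult c) (meson ana analytic_at_imp_isCont isCont_def)
    moreover have "eventually (\<lambda>w. F w / G w * G w = F w) (at z)"
      using entire_eventually_nonzero[OF G] by eventually_elim auto
    ultimately have "F \<midarrow>z\<rightarrow> c * G z"
      by (rule Lim_transform_eventually)
    moreover have "F \<midarrow>z\<rightarrow> F z"
      by (meson ana analytic_at_imp_isCont isCont_def)
    ultimately show ?thesis
      using hc LIM_unique by blast
  qed
  with h that show thesis by blast
qed

section \<open>Period integrals and Fourier coefficients of entire functions\<close>

definition period_integral :: "(complex \<Rightarrow> complex) \<Rightarrow> complex" where
  "period_integral f = contour_integral (linepath 0 (of_real (2 * pi))) f"

text \<open>Left unnormalised, without 1/(2 pi): only linear relations between coefficients and
  their vanishing matter.\<close>

definition fourier_coeff :: "(complex \<Rightarrow> complex) \<Rightarrow> int \<Rightarrow> complex" where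
  "fourier_coeff f m = period_integral (\<lambda>z. f z * exp (- \<i> * of_int m * z))"

lemma entire_primitive:
  fixes f :: "complex \<Rightarrow> complex"
  assumes "f holomorphic_on UNIV"
  obtains F where "\<And>z. (F has_field_derivative f z) (at z)"
  using holomorphic_convex_primitive'[of UNIV f] assms by auto

lemma entire_compose:
  fixes f g :: "complex \<Rightarrow> complex"
  assumes "f holomorphic_on UNIV" "g holomorphic_on UNIV"
  shows "(\<lambda>z. f (g z)) holomorphic_on UNIV"
  using holomorphic_on_compose_gen[OF assms(2,1)] by (simp add: o_def)

lemma DERIV_affine:
  fixes F f :: "complex \<Rightarrow> complex"
  assumes "\<And>z. (F has_field_derivative f z) (at z)"
  shows "((\<lambda>z. F (c * z + a)) has_field_derivative f (c * z + a) * c) (at z)"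
  by (rule DERIV_chain2[OF assms]) (auto intro!: derivative_eq_intros)

text \<open>Entire functions have primitives, so the rules for shifts, reflections and sums reduce
  to differentiating a candidate primitive.\<close>

lemma period_integral_primitive:
  assumes "\<And>z. (F has_field_derivative f z) (at z)"
  shows "period_integral f = F (of_real (2 * pi)) - F 0"
  using contour_integral_primitive[of UNIV F f "linepath 0 (of_real (2 * pi))"] assms
  unfolding period_integral_def
  by (metis contour_integral_unique pathfinish_linepath pathstart_linepath top_greatest
      valid_path_linepath)

text \<open>The increment over a period has derivative 0, so it is the same at every base point
  \<open>a\<close>, real or complex. This does the work of moving a contour.\<close>

lemma primitive_period_increment:
  assumes F: "\<And>z. (F has_field_derivative f z) (at z)"
    and per: "\<And>z. f (z + of_real (2 * pi)) = f z"
  shows "F (a + of_real (2 * pi)) - F a = period_integral f"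
proof -
  have "((\<lambda>z. F (z + of_real (2 * pi)) - F z) has_field_derivative f (z + of_real (2 * pi)) - f z) (at z)"
    for z
    using DERIV_diff[OF DERIV_affine[OF F, of 1 "of_real (2 * pi)" z] F] by simp
  then have "((\<lambda>z. F (z + of_real (2 * pi)) - F z) has_field_derivative 0) (at z within UNIV)" for z
    using per by simp
  then obtain c where "\<And>z. F (z + of_real (2 * pi)) - F z = c"
    using has_field_derivative_zero_constant[of UNIV "\<lambda>z. F (z + of_real (2 * pi)) - F z"]
    by auto
  then show ?thesis
    using period_integral_primitive[OF F] by (metis add_0)
qed

lemma period_integral_shift:
  assumes "f holomorphic_on UNIV" "\<And>z. f (z + of_real (2 * pi)) = f z"
  shows "period_integral (\<lambda>z. f (z + a)) = period_integral f"
proof -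
  obtain F where F: "\<And>z. (F has_field_derivative f z) (at z)"
    using entire_primitive[OF assms(1)] by blast
  have "((\<lambda>z. F (z + a)) has_field_derivative f (z + a)) (at z)" for z
    using DERIV_affine[OF F, of 1 a z] by simp
  from period_integral_primitive[OF this] primitive_period_increment[OF F assms(2), of a]
  show ?thesis by (simp add: add_ac)
qed

lemma period_integral_reflect:
  assumes "f holomorphic_on UNIV" "\<And>z. f (z + of_real (2 * pi)) = f z"
  shows "period_integral (\<lambda>z. f (- z)) = period_integral f"
proof -
  obtain F where F: "\<And>z. (F has_field_derivative f z) (at z)"
    using entire_primitive[OF assms(1)] by blast
  have "((\<lambda>z. - F (- z)) has_field_derivative f (- z)) (at z)" for z
    using DERIV_minus[OF DERIV_affine[OF F, of "-1" 0 z]] by simp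
  from period_integral_primitive[OF this]
    primitive_period_increment[OF F assms(2), of "- of_real (2 * pi)"]
  show ?thesis by simp
qed

lemma period_integral_bound:
  assumes "f holomorphic_on UNIV" "\<And>x. x \<in> closed_segment 0 (of_real (2 * pi)) \<Longrightarrow> norm (f x) \<le> B"
    "B \<ge> 0"
  shows "norm (period_integral f) \<le> B * (2 * pi)"
proof -
  have "f contour_integrable_on linepath 0 (of_real (2 * pi))"
    using assms(1) by (intro contour_integrable_continuous_linepath)
      (meson holomorphic_on_imp_continuous_on holomorphic_on_subset subset_UNIV)
  then have "(f has_contour_integral period_integral f) (linepath 0 (of_real (2 * pi)))"
    unfolding period_integral_def by (rule has_contour_integral_integral)
  from has_contour_integral_bound_linepath[OF this assms(3,2)] show ?thesis
    by (simp add: norm_mult)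
qed

lemma period_integral_cong: "(\<And>z. f z = g z) \<Longrightarrow> period_integral f = period_integral g"
  by presburger

lemma period_integral_sum:
  assumes "\<And>i. i \<in> I \<Longrightarrow> f i holomorphic_on UNIV" "finite I"
  shows "period_integral (\<lambda>z. \<Sum>i\<in>I. c i * f i z) = (\<Sum>i\<in>I. c i * period_integral (f i))"
proof -
  have "\<exists>F. \<forall>z. (F has_field_derivative f i z) (at z)" if "i \<in> I" for i
    using entire_primitive[OF assms(1)[OF that]] by metis
  then obtain F where F: "\<And>i z. i \<in> I \<Longrightarrow> (F i has_field_derivative f i z) (at z)"
    by metis
  have "((\<lambda>z. \<Sum>i\<in>I. c i * F i z) has_field_derivative (\<Sum>i\<in>I. c i * f i z)) (at z)" for z
    by (intro DERIV_sum DERIV_cmult F)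
  from period_integral_primitive[OF this] show ?thesis
    using period_integral_primitive[OF F] by (simp add: sum_subtractf right_diff_distrib)
qed

lemma fourier_coeff_sum:
  assumes "\<And>i. i \<in> I \<Longrightarrow> f i holomorphic_on UNIV" "finite I"
  shows "fourier_coeff (\<lambda>z. \<Sum>i\<in>I. c i * f i z) m = (\<Sum>i\<in>I. c i * fourier_coeff (f i) m)"
proof -
  have "period_integral (\<lambda>z. \<Sum>i\<in>I. c i * (f i z * exp (- \<i> * of_int m * z))) =
        (\<Sum>i\<in>I. c i * period_integral (\<lambda>z. f i z * exp (- \<i> * of_int m * z)))"
    by (rule period_integral_sum) (auto intro!: holomorphic_intros assms)
  then show ?thesis
    unfolding fourier_coeff_def by (simp only: sum_distrib_right mult.assoc)
qed

lemma fourier_coeff_lincomb: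
  assumes "f holomorphic_on UNIV" "g holomorphic_on UNIV"
  shows "fourier_coeff (\<lambda>z. a * f z + b * g z) m = a * fourier_coeff f m + b * fourier_coeff g m"
  using fourier_coeff_sum[of "{False, True}" "\<lambda>i. if i then f else g" "\<lambda>i. if i then a else b" m]
    assms by (simp add: add_ac)

lemma exp_int_period: "exp (- \<i> * of_int m * (z + of_real (2 * pi))) = exp (- \<i> * of_int m * z)"
proof -
  have "exp (- \<i> * of_int m * (z + of_real (2 * pi)))
      = exp (- \<i> * of_int m * z) * exp (\<i> * of_int (- m) * (of_real pi * 2))"
    unfolding exp_add[symmetric] by (rule arg_cong[where f = exp]) (simp add: algebra_simps)
  also have "exp (\<i> * of_int (- m) * (of_real pi * 2)) = 1"
    using exp_integer_2pi[of "of_int (- m)"] by (simp add: algebra_simps)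
  finally show ?thesis by simp
qed

text \<open>As \<open>a\<close> may be complex, this covers the quasi-period
  \<open>of_real pi * T\<close> as well as a shift off the real line.\<close>

lemma fourier_coeff_shift:
  assumes "f holomorphic_on UNIV" "\<And>z. f (z + of_real (2 * pi)) = f z"
  shows "fourier_coeff (\<lambda>z. f (z + a)) m = exp (\<i> * of_int m * a) * fourier_coeff f m"
proof -
  let ?g = "\<lambda>z. f z * exp (- \<i> * of_int m * z)"
  have hol: "?g holomorphic_on UNIV" by (intro holomorphic_intros assms)
  have holf: "(\<lambda>z. f (z + a)) holomorphic_on UNIV"
    by (rule entire_compose, rule assms, intro holomorphic_intros)
  have "fourier_coeff f m = period_integral (\<lambda>z. ?g (z + a))"
    unfolding fourier_coeff_def
    by (rule period_integral_shift[symmetric, OF hol]) (simp only: assms exp_int_period)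
  \<comment> \<open>The sum over a single index lets \<open>period_integral_sum\<close> pull out the
    constant factor.\<close>
  also have "\<dots> = period_integral (\<lambda>z. \<Sum>i\<in>{()}. exp (- \<i> * of_int m * a) *
                    (f (z + a) * exp (- \<i> * of_int m * z)))"
    by (rule period_integral_cong) (simp add: exp_add exp_diff exp_minus field_simps)
  also have "\<dots> = exp (- \<i> * of_int m * a) * fourier_coeff (\<lambda>z. f (z + a)) m"
    unfolding fourier_coeff_def
    using holf by (subst period_integral_sum) (auto intro!: holomorphic_intros)
  finally show ?thesis by (simp add: exp_minus field_simps)
qed

lemma fourier_coeff_reflect:
  assumes "f holomorphic_on UNIV" "\<And>z. f (z + of_real (2 * pi)) = f z"
  shows "fourier_coeff (\<lambda>z. f (- z)) m = fourier_coeff f (- m)"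
proof -
  let ?g = "\<lambda>z. f z * exp (- \<i> * of_int (- m) * z)"
  have hol: "?g holomorphic_on UNIV" by (intro holomorphic_intros assms)
  have "period_integral (\<lambda>z. ?g (- z)) = period_integral ?g"
    by (rule period_integral_reflect[OF hol]) (simp only: assms exp_int_period)
  then show ?thesis
    unfolding fourier_coeff_def by simp
qed

lemma fourier_coeff_mult_exp:
  "fourier_coeff (\<lambda>z. exp (\<i> * of_int k * z) * f z) m = fourier_coeff f (m - k)"
  unfolding fourier_coeff_def
  by (rule period_integral_cong) (simp add: algebra_simps flip: exp_add)

text \<open>Moving the line of integration down by \<i> multiplies the k-th coefficient by exp k,
  while the integral stays bounded by the maximum of \<open>f\<close> on one segment. The
  coefficients thus decay exponentially; negative indices are reached by applying this to the
  reflected function.\<close>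

lemma fourier_coeff_tendsto_0:
  assumes "f holomorphic_on UNIV" "\<And>z. f (z + of_real (2 * pi)) = f z"
  shows "(\<lambda>k. fourier_coeff f (int k)) \<longlonglongrightarrow> 0"
proof -
  let ?S = "closed_segment 0 (complex_of_real (2 * pi))"
  have hol: "(\<lambda>z. f (z + a)) holomorphic_on UNIV" for a
    by (rule entire_compose, rule assms, intro holomorphic_intros)
  have "compact ((\<lambda>z. f (z - \<i>)) ` ?S)"
    using holomorphic_on_imp_continuous_on[OF hol[of "- \<i>"]]
    by (intro compact_continuous_image) (auto intro: continuous_on_subset)
  then obtain B where B: "B > 0" "\<And>x. x \<in> ?S \<Longrightarrow> norm (f (x - \<i>)) \<le> B"
    using compact_imp_bounded[of "(\<lambda>z. f (z - \<i>)) ` ?S"] unfolding bounded_pos by blast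
  have bound: "norm (fourier_coeff f (int k)) \<le> (B * (2 * pi)) * exp (- 1) ^ k" for k
  proof -
    have "norm (fourier_coeff (\<lambda>z. f (z + - \<i>)) (int k)) \<le> B * (2 * pi)"
      unfolding fourier_coeff_def
    proof (rule period_integral_bound)
      fix x assume x: "x \<in> ?S"
      then obtain u where "x = of_real (u * (2 * pi))"
        by (auto simp: closed_segment_def scaleR_conv_of_real)
      then have n1: "norm (exp (- \<i> * of_int (int k) * x)) = 1"
        by (simp add: norm_exp_eq_Re)
      show "norm (f (x + - \<i>) * exp (- \<i> * of_int (int k) * x)) \<le> B"
        using B(2)[OF x] by (simp only: norm_mult n1 mult_1_right add_uminus_conv_diff)
    qed (use B hol[of "- \<i>"] in \<open>auto intro!: holomorphic_intros\<close>)
    moreover have "fourier_coeff (\<lambda>z. f (z + - \<i>)) (int k) = exp (of_nat k) * fourier_coeff f (int k)"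
      using fourier_coeff_shift[OF assms, of "- \<i>" "int k"] by (simp add: field_simps)
    ultimately have "exp (real k) * norm (fourier_coeff f (int k)) \<le> B * (2 * pi)"
      by (simp add: norm_mult norm_exp_eq_Re)
    then show ?thesis
      by (simp add: exp_minus field_simps flip: exp_of_nat_mult)
  qed
  have "(\<lambda>k. (B * (2 * pi)) * exp (- 1 :: real) ^ k) \<longlonglongrightarrow> (B * (2 * pi)) * 0"
    by (intro tendsto_mult tendsto_const LIMSEQ_power_zero) auto
  then show ?thesis
    using bound by (subst (asm) mult_zero_right) (rule Lim_null_comparison, auto)
qed

text \<open>
  Chernoff's argument: dividing \<open>f - f 0\<close> by \<open>exp (\<i> z) - 1\<close> makes the coefficients of \<open>f\<close>
  telescope, and the coefficients of the quotient decay.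
\<close>

lemma fourier_coeffs_0_imp_0_at_0:
  assumes hol: "f holomorphic_on UNIV" and per: "\<And>z. f (z + of_real (2 * pi)) = f z"
    and zero: "\<And>m. fourier_coeff f m = 0"
  shows "f 0 = 0"
proof -
  let ?F = "\<lambda>z. f z - f 0" and ?G = "\<lambda>z. exp (\<i> * z) - 1"
  \<comment> \<open>\<open>?G\<close> vanishes exactly at the multiples of 2 pi. There
    \<open>?F\<close> vanishes by periodicity and \<open>?G\<close> has a nonzero derivative, so the
    quotient tends to the ratio of the derivatives.\<close>
  have lim: "\<exists>c. (\<lambda>w. ?F w / ?G w) \<midarrow>z\<rightarrow> c" for z
  proof (cases "?G z = 0")
    case True
    have df: "(?F has_field_derivative deriv f z) (at z)"
      using holomorphic_derivI[OF hol, of z] by (auto intro!: derivative_eq_intros)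
    have dg: "(?G has_field_derivative \<i> * exp (\<i> * z)) (at z)"
      by (auto intro!: derivative_eq_intros)
    have "exp (\<i> * z) = exp 0"
      using True by simp
    then obtain k :: int where "\<i> * z = 0 + complex_of_real (real_of_int (2 * k) * pi) * \<i>"
      unfolding exp_eq by blast
    then have "\<i> * z = \<i> * (of_int k * of_real (2 * pi))"
      by (simp add: mult_ac)
    then have "z = of_int k * of_real (2 * pi)"
      by (simp only: mult_cancel_left complex_i_not_zero simp_thms)
    moreover have "f (of_int j * of_real (2 * pi)) = f 0" for j
    proof (induction j)
      case (nonneg n)
      then show ?case
      proof (induction n)
        case (Suc n)
        then show ?case using per[of "of_nat n * of_real (2 * pi)"] by (simp add: algebra_simps)
      qed simp
    next
      case (neg n)
      have "f (- (of_nat n * of_real (2 * pi))) = f 0" for n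
      proof (induction n)
        case (Suc n)
        then show ?case using per[of "- (of_nat (Suc n) * of_real (2 * pi))"]
          by (simp add: algebra_simps)
      qed simp
      from this[of "Suc n"] show ?case by (simp add: algebra_simps)
    qed
    ultimately have Fz: "?F z = 0" by simp
    have "eventually (\<lambda>w. ?F w / ?G w = ((?F w - ?F z) / (w - z)) / ((?G w - ?G z) / (w - z))) (at z)"
      unfolding True using Fz
      by (auto simp: eventually_at intro!: exI[of _ 1])
    moreover have "(\<lambda>w. ((?F w - ?F z) / (w - z)) / ((?G w - ?G z) / (w - z))) \<midarrow>z\<rightarrow>
        deriv f z / (\<i> * exp (\<i> * z))"
      using df dg unfolding has_field_derivative_iff by (intro tendsto_divide) auto
    ultimately have "(\<lambda>w. ?F w / ?G w) \<midarrow>z\<rightarrow> deriv f z / (\<i> * exp (\<i> * z))"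
      by (rule tendsto_cong[THEN iffD2])
    then show ?thesis ..
  next
    case False
    have "isCont f z"
      using hol by (meson UNIV_I holomorphic_on_imp_continuous_on continuous_on_eq_continuous_at open_UNIV)
    then show ?thesis
      using False by (intro exI[of _ "?F z / ?G z"] isContD continuous_intros) auto
  qed
  have Gpi: "?G (of_real pi) \<noteq> 0"
    using exp_pi_i by (simp add: mult.commute)
  have holFG: "?F holomorphic_on UNIV" "?G holomorphic_on UNIV"
    by (intro holomorphic_intros hol)+
  obtain h where h: "h holomorphic_on UNIV" "\<And>z. h z * ?G z = ?F z"
    using entire_quotient[OF holFG Gpi lim] by blast
  have hper: "h (z + of_real (2 * pi)) = h z" for z
  proof -
    have Gper: "?G (z + of_real (2 * pi)) = ?G z" for z
      using exp_int_period[of "-1" z] by simp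
    have hol_diff: "(\<lambda>z. h (z + of_real (2 * pi)) - h z) holomorphic_on UNIV"
      by (rule holomorphic_on_diff[OF entire_compose[OF h(1)] h(1)]) (intro holomorphic_intros)
    have "(h (z + of_real (2 * pi)) - h z) * ?G z = 0" for z
      using h(2)[of z] h(2)[of "z + of_real (2 * pi)"]
      by (simp only: Gper per left_diff_distrib right_minus_eq)
    then have "h (z + of_real (2 * pi)) - h z = 0"
      by (rule entire_mult_eq_0D[OF hol_diff holFG(2) Gpi])
    then show ?thesis by simp
  qed
  have c1: "fourier_coeff (\<lambda>_. 1) m = 0" if "m \<noteq> 0" for m
  proof -
    have "((\<lambda>z. exp (- \<i> * of_int m * z) / (- \<i> * of_int m)) has_field_derivative
            (\<lambda>z. 1 * exp (- \<i> * of_int m * z)) z) (at z)" for z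
      using that by (auto intro!: derivative_eq_intros)
    from period_integral_primitive[OF this] show ?thesis
      using exp_int_period[of m 0] unfolding fourier_coeff_def by simp
  qed
  have c0: "fourier_coeff (\<lambda>_. 1) 0 = of_real (2 * pi)"
    using period_integral_primitive[of "\<lambda>z. z" "\<lambda>_. 1"] unfolding fourier_coeff_def by simp
  \<comment> \<open>The right-hand side is nonzero at most for \<open>m = 0\<close>. So the
    coefficients of \<open>h\<close> are constant on m >= 0 and on m <= -1, both constants are 0 by
    decay, and the jump at 0, which is \<open>f 0\<close> times 2 pi, must vanish.\<close>
  have tel: "fourier_coeff h (m - 1) - fourier_coeff h m = - f 0 * fourier_coeff (\<lambda>_. 1) m" for m
  proof -
    have "fourier_coeff (\<lambda>z. 1 * (exp (\<i> * of_int 1 * z) * h z) + (- 1) * h z) m =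
          1 * fourier_coeff (\<lambda>z. exp (\<i> * of_int 1 * z) * h z) m + (- 1) * fourier_coeff h m"
      by (rule fourier_coeff_lincomb) (auto intro!: holomorphic_intros h)
    also have "\<dots> = fourier_coeff h (m - 1) - fourier_coeff h m"
      unfolding fourier_coeff_mult_exp by simp
    also have "(\<lambda>z. 1 * (exp (\<i> * of_int 1 * z) * h z) + (- 1) * h z) = (\<lambda>z. 1 * f z + (- f 0) * 1)"
      using h(2) by (auto simp: algebra_simps fun_eq_iff)
    also have "fourier_coeff \<dots> m = 1 * fourier_coeff f m + (- f 0) * fourier_coeff (\<lambda>_. 1) m"
      by (rule fourier_coeff_lincomb) (auto intro!: holomorphic_intros hol)
    finally show ?thesis using zero by simp
  qed
  have "fourier_coeff h (int k) = fourier_coeff h 0" for k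
  proof (induction k)
    case (Suc k)
    then show ?case using tel[of "int (Suc k)"] c1[of "int (Suc k)"] by simp
  qed simp
  then have pos: "fourier_coeff h 0 = 0"
    using fourier_coeff_tendsto_0[OF h(1) hper] by (simp add: LIMSEQ_const_iff)
  have "fourier_coeff h (- 1 - int k) = fourier_coeff h (- 1)" for k
  proof (induction k)
    case (Suc k)
    then show ?case using tel[of "- 1 - int k"] c1[of "- 1 - int k"] by (simp add: algebra_simps)
  qed simp
  moreover have "(\<lambda>k. fourier_coeff (\<lambda>z. h (- z)) (int k)) \<longlonglongrightarrow> 0"
  proof (rule fourier_coeff_tendsto_0)
    show "(\<lambda>z. h (- z)) holomorphic_on UNIV"
      by (rule entire_compose, rule h(1), intro holomorphic_intros)
    show "h (- (z + of_real (2 * pi))) = h (- z)" for z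
      using hper[of "- z - of_real (2 * pi)"] by (simp add: algebra_simps)
  qed
  then have "(\<lambda>k. fourier_coeff h (- int (Suc k))) \<longlonglongrightarrow> 0"
    unfolding fourier_coeff_reflect[OF h(1) hper] by (rule LIMSEQ_Suc)
  ultimately have "fourier_coeff h (- 1) = 0"
    by (simp add: LIMSEQ_const_iff)
  then show ?thesis
    using tel[of 0] pos c0 by simp
qed

lemma fourier_coeffs_0_imp_0:
  assumes hol: "f holomorphic_on UNIV" and per: "\<And>z. f (z + of_real (2 * pi)) = f z"
    and zero: "\<And>m. fourier_coeff f m = 0"
  shows "f z = 0"
proof -
  have "(\<lambda>w. f (w + z)) 0 = 0"
  proof (rule fourier_coeffs_0_imp_0_at_0)
    show "(\<lambda>w. f (w + z)) holomorphic_on UNIV"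
      by (rule entire_compose, rule hol, intro holomorphic_intros)
    show "f (w + of_real (2 * pi) + z) = f (w + z)" for w
      using per[of "w + z"] by (simp add: add_ac)
  qed (simp add: fourier_coeff_shift[OF hol per] zero)
  then show ?thesis by simp
qed

section \<open>Spaces of symmetric theta functions\<close>

text \<open>The multiplier is the n-th power of the one that \<open>theta1\<close> and
  \<open>theta4\<close> of modulus \<open>T\<close> share. The period is 2 pi because
  \<open>theta1\<close> changes sign under pi. The reflection about pi/2 fixes both functions, as
  one is odd and antiperiodic under pi, the other even and periodic.\<close>

definition theta_space :: "complex \<Rightarrow> nat \<Rightarrow> (complex \<Rightarrow> complex) set" where
  "theta_space T n = {f. f holomorphic_on UNIV \<and> (\<forall>z. f (z + of_real (2 * pi)) = f z) \<and>
     (\<forall>z. f (of_real pi - z) = f z) \<and>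
     (\<forall>z. f (z + of_real pi * T) = (- exp (- \<i> * of_real pi * T - 2 * \<i> * z)) ^ n * f z)}"

lemma theta_spaceD:
  assumes "f \<in> theta_space T n"
  shows "f holomorphic_on UNIV" "f (z + of_real (2 * pi)) = f z" "f (of_real pi - z) = f z"
    "f (z + of_real pi * T) = (- exp (- \<i> * of_real pi * T - 2 * \<i> * z)) ^ n * f z"
  using assms by (auto simp: theta_space_def)

lemma theta_space_sum:
  assumes "\<And>i. i \<in> I \<Longrightarrow> f i \<in> theta_space T n"
  shows "(\<lambda>z. \<Sum>i\<in>I. c i * f i z) \<in> theta_space T n"
  unfolding theta_space_def using assms[THEN theta_spaceD(1)]
  by (auto intro!: holomorphic_intros sum.cong
      simp: sum_distrib_left theta_spaceD(2-)[OF assms] mult.left_commute simp del: of_real_mult)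

lemma theta_space_lincomb:
  assumes "f \<in> theta_space T n" "g \<in> theta_space T n"
  shows "(\<lambda>z. a * f z + b * g z) \<in> theta_space T n"
  using theta_space_sum[of "{False, True}" "\<lambda>i. if i then f else g" T n "\<lambda>i. if i then a else b"]
    assms by (simp add: add_ac)

lemma theta_space_mult:
  assumes "f \<in> theta_space T m" "g \<in> theta_space T n"
  shows "(\<lambda>z. f z * g z) \<in> theta_space T (m + n)"
  unfolding theta_space_def using theta_spaceD(1)[OF assms(1)] theta_spaceD(1)[OF assms(2)]
  by (auto intro!: holomorphic_intros simp: theta_spaceD(2-)[OF assms(1)] theta_spaceD(2-)[OF assms(2)]
      power_add simp del: of_real_mult)

lemma theta_space_1: "(\<lambda>z. 1) \<in> theta_space T 0"
  by (simp add: theta_space_def)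

lemma theta_space_power:
  assumes "f \<in> theta_space T 1"
  shows "(\<lambda>z. f z ^ n) \<in> theta_space T n"
proof (induction n)
  case (Suc n)
  then show ?case using theta_space_mult[OF assms Suc] by simp
qed (simp add: theta_space_1)

lemma theta_space_coeff_uminus:
  assumes "f \<in> theta_space T n"
  shows "fourier_coeff f m = exp (\<i> * of_int (- m) * of_real pi) * fourier_coeff f (- m)"
proof -
  note f = theta_spaceD[OF assms]
  have "(\<lambda>z. f (z + of_real pi)) holomorphic_on UNIV"
    by (rule entire_compose, rule f, intro holomorphic_intros)
  moreover have "f (z + of_real (2 * pi) + of_real pi) = f (z + of_real pi)" for z
    using f(2)[of "z + of_real pi"] by (simp add: add_ac)
  ultimately have "fourier_coeff (\<lambda>z. f (- z + of_real pi)) m =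
      fourier_coeff (\<lambda>z. f (z + of_real pi)) (- m)"
    by (rule fourier_coeff_reflect)
  also have "(\<lambda>z. f (- z + of_real pi)) = f"
    using f(3) by (simp add: add.commute)
  finally show ?thesis
    using fourier_coeff_shift[OF f(1,2), of "of_real pi" "- m"] by simp
qed

text \<open>The coefficients of the shifted function are computed twice: by the shift rule, and from
  the multiplier, whose factor exp (-2 \<i> n z) moves the index by 2n.\<close>

lemma theta_space_coeff_step:
  assumes "f \<in> theta_space T n"
  shows "exp (\<i> * of_int m * (of_real pi * T)) * fourier_coeff f m =
    (- exp (- \<i> * of_real pi * T)) ^ n * fourier_coeff f (m + 2 * int n)"
proof -
  note f = theta_spaceD[OF assms]
  let ?g = "\<lambda>z. exp (\<i> * of_int (- 2 * int n) * z) * f z"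
  have "exp (\<i> * of_int m * (of_real pi * T)) * fourier_coeff f m =
    fourier_coeff (\<lambda>z. f (z + of_real pi * T)) m"
    by (rule fourier_coeff_shift[OF f(1,2), symmetric])
  \<comment> \<open>The vanishing second summand puts a scalar multiple into the form of
    \<open>fourier_coeff_lincomb\<close>.\<close>
  also have "(\<lambda>z. f (z + of_real pi * T)) =
      (\<lambda>z. (- exp (- \<i> * of_real pi * T)) ^ n * ?g z + 0 * ?g z)"
  proof
    fix z
    have "(- exp (- \<i> * of_real pi * T - 2 * \<i> * z)) ^ n =
        (- exp (- \<i> * of_real pi * T)) ^ n * exp (- 2 * \<i> * z) ^ n"
      by (simp add: exp_diff exp_minus field_simps flip: power_mult_distrib)
    also have "exp (- 2 * \<i> * z) ^ n = exp (\<i> * of_int (- 2 * int n) * z)"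
      by (simp add: mult_ac flip: exp_of_nat_mult)
    finally show "f (z + of_real pi * T) = (- exp (- \<i> * of_real pi * T)) ^ n * ?g z + 0 * ?g z"
      using f(4)[of z] by simp
  qed
  also have "fourier_coeff \<dots> m = (- exp (- \<i> * of_real pi * T)) ^ n * fourier_coeff ?g m + 0 * fourier_coeff ?g m"
    by (rule fourier_coeff_lincomb) (intro holomorphic_intros f)+
  also have "fourier_coeff ?g m = fourier_coeff f (m - (- 2 * int n))"
    by (rule fourier_coeff_mult_exp)
  finally show ?thesis by simp
qed

text \<open>The recursion joins indices that differ by 2n and the reflection joins m and -m, so
  every index is joined to one in 0..n; a residue r with n < r < 2n goes through 2n - r. For n = 0
  the recursion does not move the index, but it multiplies the coefficient by a number of modulus
  different from 1 when m > 0, because \<open>Im T > 0\<close>.\<close>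

lemma theta_space_determined:
  assumes f: "f \<in> theta_space T n" and T: "Im T > 0"
    and zero: "\<And>i. i \<le> n \<Longrightarrow> fourier_coeff f (int i) = 0"
  shows "f z = 0"
proof -
  have step: "fourier_coeff f (m + 2 * int n) = 0 \<longleftrightarrow> fourier_coeff f m = 0" for m
    using theta_space_coeff_step[OF f, of m] by auto
  have steps: "fourier_coeff f (m + 2 * int n * int k) = 0 \<longleftrightarrow> fourier_coeff f m = 0" for m k
  proof (induction k)
    case (Suc k)
    then show ?case using step[of "m + 2 * int n * int k"] by (simp add: algebra_simps)
  qed simp
  have refl: "fourier_coeff f (- m) = 0" if "fourier_coeff f m = 0" for m
    using theta_space_coeff_uminus[OF f, of "- m"] that by simp
  have nonneg: "fourier_coeff f (int m) = 0" for m
  proof (cases "n = 0")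
    case True
    show ?thesis
    proof (cases "m = 0")
      case False
      have "norm (exp (\<i> * of_int (int m) * (of_real pi * T))) \<noteq> 1"
        using False T by (simp add: norm_exp_eq_Re)
      then have "exp (\<i> * of_int (int m) * (of_real pi * T)) \<noteq> 1"
        by (metis norm_one)
      then show ?thesis
        using theta_space_coeff_step[OF f, of "int m"] True by simp
    qed (use zero[of 0] in simp)
  next
    case False
    define r where "r = m mod (2 * n)"
    have "m = r + 2 * n * (m div (2 * n))"
      unfolding r_def by simp
    from arg_cong[OF this, of int] have r: "int m = int r + 2 * int n * int (m div (2 * n))"
      by (simp only: of_nat_add of_nat_mult of_nat_numeral)
    show ?thesis
    proof (cases "r \<le> n")
      case True
      then show ?thesis using steps r zero by metis
    next
      case gt: False
      have "r < 2 * n" using False unfolding r_def by simp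
      then have "fourier_coeff f (- int (2 * n - r)) = 0"
        using gt by (intro refl zero) simp
      moreover have "- int (2 * n - r) + 2 * int n = int r"
        using \<open>r < 2 * n\<close> by simp
      ultimately have "fourier_coeff f (int r) = 0"
        using step[of "- int (2 * n - r)"] by simp
      then show ?thesis using steps r by metis
    qed
  qed
  have "fourier_coeff f m = 0" for m
    using nonneg[of "nat m"] refl[OF nonneg[of "nat (- m)"]] by (cases "m \<ge> 0") auto
  then show ?thesis
    using fourier_coeffs_0_imp_0[OF theta_spaceD(1,2)[OF f]] by blast
qed

section \<open>Linear relations between theta functions and spanning by monomials\<close>

lemma homogeneous_system_nontrivial:
  fixes a :: "'j \<Rightarrow> 'i \<Rightarrow> 'a::field"
  assumes "finite I" "finite J" "card I < card J"
  shows "\<exists>c. (\<exists>j\<in>J. c j \<noteq> 0) \<and> (\<forall>i\<in>I. (\<Sum>j\<in>J. c j * a j i) = 0)"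
  using assms
proof (induction I arbitrary: J a rule: finite_induct)
  case empty
  then obtain j where "j \<in> J" by fastforce
  then show ?case by (intro exI[of _ "\<lambda>_. 1"]) auto
next
  case (insert i0 I)
  show ?case
  proof (cases "\<forall>j\<in>J. a j i0 = 0")
    case True
    then show ?thesis using insert.IH[of J a] insert.prems insert.hyps by auto
  next
    case False
    \<comment> \<open>Gaussian elimination: equation \<open>i0\<close> contains the unknown
      \<open>p\<close>, which is solved for and substituted into the remaining equations.\<close>
    then obtain p where p: "p \<in> J" "a p i0 \<noteq> 0" by blast
    let ?J = "J - {p}"
    have J: "J = insert p ?J" "p \<notin> ?J" "finite ?J" using p insert.prems by auto
    have "card I < card ?J" using insert.prems insert.hyps p by simp
    from insert.IH[OF J(3) this, of "\<lambda>j i. a j i - a j i0 / a p i0 * a p i"]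
    obtain c where c: "\<exists>j\<in>?J. c j \<noteq> 0"
      "\<And>i. i \<in> I \<Longrightarrow> (\<Sum>j\<in>?J. c j * (a j i - a j i0 / a p i0 * a p i)) = 0" by blast
    \<comment> \<open>The value that equation \<open>i0\<close> forces on the eliminated
      unknown.\<close>
    define cp where "cp = - (\<Sum>j\<in>?J. c j * a j i0) / a p i0"
    have sum: "(\<Sum>j\<in>J. (c(p := cp)) j * a j i) = cp * a p i + (\<Sum>j\<in>?J. c j * a j i)" for i
    proof -
      have "(\<Sum>j\<in>J. (c(p := cp)) j * a j i) = cp * a p i + (\<Sum>j\<in>?J. (c(p := cp)) j * a j i)"
        by (subst J(1), subst sum.insert[OF J(3,2)]) simp
      also have "(\<Sum>j\<in>?J. (c(p := cp)) j * a j i) = (\<Sum>j\<in>?J. c j * a j i)"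
        by (rule sum.cong) auto
      finally show ?thesis .
    qed
    have "(\<Sum>j\<in>J. (c(p := cp)) j * a j i) = 0" if "i \<in> insert i0 I" for i
    proof (cases "i = i0")
      case True
      then show ?thesis unfolding sum using p by (simp add: cp_def)
    next
      case False
      then have "(\<Sum>j\<in>?J. c j * (a j i - a j i0 / a p i0 * a p i)) = 0"
        using that c by auto
      also have "(\<Sum>j\<in>?J. c j * (a j i - a j i0 / a p i0 * a p i)) =
          (\<Sum>j\<in>?J. c j * a j i - c j * a j i0 / a p i0 * a p i)"
        by (rule sum.cong) (simp_all add: algebra_simps)
      finally have "(\<Sum>j\<in>?J. c j * a j i) = (\<Sum>j\<in>?J. c j * a j i0) / a p i0 * a p i"
        by (simp add: sum_subtractf sum_distrib_right sum_divide_distrib)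
      then show ?thesis unfolding sum by (simp add: cp_def)
    qed
    then show ?thesis using c(1) by (intro exI[of _ "c(p := cp)"]) auto
  qed
qed

text \<open>The dimension bound: n + 1 coefficients must vanish, and there are more unknowns than
  that. It speaks of indexed families, so that coinciding members also count as dependent.\<close>

lemma theta_space_dependent:
  assumes T: "Im T > 0" and f: "\<And>j. j \<in> J \<Longrightarrow> f j \<in> theta_space T n"
    and J: "finite J" "card J > n + 1"
  shows "\<exists>c. (\<exists>j\<in>J. c j \<noteq> 0) \<and> (\<forall>z. (\<Sum>j\<in>J. c j * f j z) = 0)"
proof -
  obtain c where c: "\<exists>j\<in>J. c j \<noteq> 0"
    "\<And>i. i \<le> n \<Longrightarrow> (\<Sum>j\<in>J. c j * fourier_coeff (f j) (int i)) = 0"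
    using homogeneous_system_nontrivial[of "{..n}" J "\<lambda>j i. fourier_coeff (f j) (int i)"] J by auto
  have "(\<Sum>j\<in>J. c j * f j z) = 0" for z
  proof (rule theta_space_determined[OF theta_space_sum[OF f] T])
    fix i assume "i \<le> n"
    then show "fourier_coeff (\<lambda>z. \<Sum>j\<in>J. c j * f j z) (int i) = 0"
      using c(2) fourier_coeff_sum[of J f c "int i"] theta_spaceD(1)[OF f] J by simp
  qed
  with c show ?thesis by blast
qed

text \<open>For entire functions this means that \<open>V\<close> is not identically 0 and
  \<open>U / V\<close> is not constant off the zeros of \<open>V\<close>. The linear form passes
  easily through invertible combinations.\<close>

definition independent_pair :: "(complex \<Rightarrow> complex) \<Rightarrow> (complex \<Rightarrow> complex) \<Rightarrow> bool" where
  "independent_pair U V \<longleftrightarrow> (\<forall>a b. (\<forall>z. a * U z + b * V z = 0) \<longrightarrow> a = 0 \<and> b = 0)"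

lemma independent_pairD:
  assumes "independent_pair U V" "(a, b) \<noteq> (0, 0)"
  obtains z where "a * U z + b * V z \<noteq> 0"
  using assms unfolding independent_pair_def by blast

text \<open>The zeros of \<open>V\<close> are countable, so their complement is connected. A finite
  connected image is a point, which would make \<open>U\<close> a multiple of
  \<open>V\<close>.\<close>

lemma infinite_range_quotient:
  assumes U: "U holomorphic_on UNIV" and V: "V holomorphic_on UNIV" and ind: "independent_pair U V"
  shows "infinite ((\<lambda>z. U z / V z) ` {z. V z \<noteq> 0})"
proof
  assume fin: "finite ((\<lambda>z. U z / V z) ` {z. V z \<noteq> 0})"
  obtain b where b: "V b \<noteq> 0"
    using independent_pairD[OF ind, of 0 1] by auto
  have "countable {z \<in> UNIV. V z = 0}"
  proof (cases "V constant_on UNIV")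
    case True
    then have "{z \<in> UNIV. V z = 0} = {}" using b by (auto simp: constant_on_def)
    then show ?thesis by simp
  next
    case False
    then show ?thesis using V by (intro holomorphic_countable_zeros) auto
  qed
  then have "connected (- {z \<in> UNIV. V z = 0})"
    by (intro path_connected_imp_connected path_connected_complement_countable) auto
  moreover have "- {z \<in> UNIV. V z = 0} = {z. V z \<noteq> 0}" by auto
  moreover have "continuous_on {z. V z \<noteq> 0} (\<lambda>z. U z / V z)"
    using U V by (intro continuous_on_divide) (auto intro: holomorphic_on_imp_continuous_on holomorphic_on_subset)
  ultimately have conn: "connected ((\<lambda>z. U z / V z) ` {z. V z \<noteq> 0})"
    using connected_continuous_image by metis
  with fin b obtain a where "(\<lambda>z. U z / V z) ` {z. V z \<noteq> 0} = {a}"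
    unfolding connected_finite_iff_sing[OF conn] by auto
  then have a: "U z = a * V z" if "V z \<noteq> 0" for z
  proof -
    have "U z / V z \<in> {a}"
      using \<open>_ = {a}\<close> that by blast
    then show ?thesis using that by (simp add: field_simps)
  qed
  have "U z - a * V z = 0" for z
    by (rule entire_mult_eq_0D[OF _ V b]) (use a in \<open>auto intro!: holomorphic_intros U V\<close>)
  then have "\<forall>z. 1 * U z + (- a) * V z = 0" by simp
  then show False using ind unfolding independent_pair_def by fastforce
qed

text \<open>The n + 1 monomials together with \<open>f\<close> exceed the dimension bound, so they
  satisfy a relation. If \<open>f\<close> were absent from it, division by \<open>V z ^ n\<close>
  would give a nonzero polynomial vanishing on the infinite range of \<open>U / V\<close>.\<close>

lemma theta_space_spanned:
  assumes T: "Im T > 0" and U: "U \<in> theta_space T 1" and V: "V \<in> theta_space T 1"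
    and ind: "independent_pair U V" and f: "f \<in> theta_space T n"
  shows "\<exists>c. \<forall>z. f z = (\<Sum>i\<le>n. c i * (U z ^ i * V z ^ (n - i)))"
proof -
  let ?g = "\<lambda>i z. U z ^ i * V z ^ (n - i)"
  let ?f = "\<lambda>i. if i = Suc n then f else ?g i"
  have g: "?g i \<in> theta_space T n" if "i \<le> n" for i
    using theta_space_mult[OF theta_space_power[OF U, of i] theta_space_power[OF V, of "n - i"]] that by simp
  have "\<exists>c. (\<exists>j\<in>{..Suc n}. c j \<noteq> 0) \<and> (\<forall>z. (\<Sum>j\<in>{..Suc n}. c j * ?f j z) = 0)"
    by (rule theta_space_dependent[OF T]) (use f g in auto)
  then obtain c where c: "\<exists>j\<in>{..Suc n}. c j \<noteq> 0" "\<And>z. (\<Sum>j\<in>{..Suc n}. c j * ?f j z) = 0"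
    by blast
  have rel: "(\<Sum>i\<le>n. c i * ?g i z) + c (Suc n) * f z = 0" for z
  proof -
    have "(\<Sum>i\<le>n. c i * ?f i z) = (\<Sum>i\<le>n. c i * ?g i z)"
      by (rule sum.cong) auto
    then show ?thesis using c(2)[of z] by simp
  qed
  have "c (Suc n) \<noteq> 0"
  proof
    assume c0: "c (Suc n) = 0"
    define P where "P = (\<Sum>i\<le>n. monom (c i) i)"
    have "coeff P j = (if j \<le> n then c j else 0)" for j
      unfolding P_def by (simp add: coeff_sum)
    then have "P \<noteq> 0"
      using c(1) c0 by (metis atMost_iff coeff_0 le_Suc_eq)
    moreover have "poly P (U z / V z) = 0" if "V z \<noteq> 0" for z
    proof -
      have "V z ^ n * poly P (U z / V z) = (\<Sum>i\<le>n. c i * ?g i z)"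
        unfolding P_def poly_sum sum_distrib_left
        by (rule sum.cong) (use that in \<open>auto simp: poly_monom field_simps simp flip: power_add\<close>)
      then show ?thesis using rel[of z] c0 that by simp
    qed
    then have "(\<lambda>z. U z / V z) ` {z. V z \<noteq> 0} \<subseteq> {x. poly P x = 0}" by auto
    ultimately show False
      using infinite_range_quotient[OF theta_spaceD(1)[OF U] theta_spaceD(1)[OF V] ind]
        poly_roots_finite finite_subset by blast
  qed
  then have "f z = - (\<Sum>i\<le>n. c i * ?g i z) / c (Suc n)" for z
    using rel[of z] by (simp only: eq_divide_eq eq_neg_iff_add_eq_0) (simp add: add.commute mult.commute)
  then have "f z = (\<Sum>i\<le>n. (- c i / c (Suc n)) * ?g i z)" for z
    by (simp add: sum_divide_distrib sum_negf)
  then show ?thesis by (intro exI[of _ "\<lambda>i. - c i / c (Suc n)"]) blast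
qed

text \<open>Here the multiplier is 1, so the function is doubly periodic; its dependence with the
  constant 1 plays the part of Liouville's theorem.\<close>

lemma theta_space_0_const:
  assumes T: "Im T > 0" and h: "h \<in> theta_space T 0"
  shows "\<exists>c. \<forall>z. h z = c"
proof -
  have "\<exists>c. (\<exists>j\<in>{False, True}. c j \<noteq> 0) \<and>
      (\<forall>z. (\<Sum>j\<in>{False, True}. c j * (if j then h else (\<lambda>_. 1)) z) = 0)"
    by (rule theta_space_dependent[OF T]) (use h theta_space_1 in auto)
  then obtain c :: "bool \<Rightarrow> complex" where c: "c False \<noteq> 0 \<or> c True \<noteq> 0" "\<And>z. c True * h z + c False = 0"
    by (auto simp: add.commute)
  then have "c True \<noteq> 0" by auto
  then have "h z = - c False / c True" for z
    using c(2)[of z] by (simp add: field_simps eq_neg_iff_add_eq_0)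
  then show ?thesis by blast
qed

lemma theta_space_ratio_const:
  assumes T: "Im T > 0" and F: "F \<in> theta_space T n" and G: "G \<in> theta_space T n" "G b \<noteq> 0"
    and lim: "\<And>z. \<exists>c. (\<lambda>w. F w / G w) \<midarrow>z\<rightarrow> c"
  shows "\<exists>c. \<forall>z. F z = c * G z"
proof -
  note F' = theta_spaceD[OF F] and G' = theta_spaceD[OF G(1)]
  obtain h where h: "h holomorphic_on UNIV" "\<And>z. h z * G z = F z"
    using entire_quotient[OF F'(1) G'(1) G(2) lim] by blast
  \<comment> \<open>\<open>F\<close> and \<open>G\<close> pick up the same factor \<open>e\<close>
    under each of the three substitutions, so the quotient picks up none. Multiplying by
    \<open>G\<close> first avoids dividing at its zeros.\<close>
  have invariant: "h (g z) = h z"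
    if g: "g holomorphic_on UNIV" and "\<And>z. F (g z) = e z * F z" "\<And>z. G (g z) = e z * G z" "\<And>z. e z \<noteq> 0"
    for g e z
  proof -
    have hol: "(\<lambda>z. h (g z) - h z) holomorphic_on UNIV"
      by (rule holomorphic_on_diff[OF entire_compose[OF h(1) g] h(1)])
    have "(h (g z) - h z) * G z = 0" for z
      using h(2)[of "g z"] h(2)[of z] that(2,3,4)[of z] by (simp add: algebra_simps)
    from entire_mult_eq_0D[OF hol G'(1) G(2) this] show ?thesis by simp
  qed
  have "h \<in> theta_space T 0"
    unfolding theta_space_def
  proof safe
    show "h (z + of_real (2 * pi)) = h z" for z
      by (rule invariant[of _ "\<lambda>_. 1"]) (use F'(2) G'(2) in \<open>auto intro!: holomorphic_intros\<close>)
    show "h (of_real pi - z) = h z" for z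
      by (rule invariant[of _ "\<lambda>_. 1"]) (use F'(3) G'(3) in \<open>auto intro!: holomorphic_intros\<close>)
    show "h (z + of_real pi * T) = (- exp (- \<i> * of_real pi * T - 2 * \<i> * z)) ^ 0 * h z" for z
      using invariant[of "\<lambda>z. z + of_real pi * T" "\<lambda>z. (- exp (- \<i> * of_real pi * T - 2 * \<i> * z)) ^ n" z]
        F'(4) G'(4) holomorphic_on_add[OF holomorphic_on_ident holomorphic_on_const] by simp
  qed (fact h(1))
  then show ?thesis
    using theta_space_0_const[OF T] h(2) by metis
qed

section \<open>Limits on the sphere\<close>

text \<open>Convergence to a point of the one-point compactification, one filter condition per case.
  It serves to identify values of \<open>to_sphere\<close> by limits.\<close>

definition sphere_lim :: "(complex \<Rightarrow> complex) \<Rightarrow> complex \<Rightarrow> sphere \<Rightarrow> bool" where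
  "sphere_lim f z w \<longleftrightarrow>
     (case w of None \<Rightarrow> filterlim f at_infinity (at z) | Some c \<Rightarrow> f \<midarrow>z\<rightarrow> c)"

lemma sphere_lim_simps [simp]:
  "sphere_lim f z None \<longleftrightarrow> filterlim f at_infinity (at z)"
  "sphere_lim f z (Some c) \<longleftrightarrow> f \<midarrow>z\<rightarrow> c"
  by (simp_all add: sphere_lim_def)

lemma to_sphere_eqI:
  assumes "sphere_lim f z w"
  shows "to_sphere f z = w"
proof (cases w)
  case (Some c)
  then have "\<not> is_pole f z"
    using assms not_tendsto_and_filterlim_at_infinity[of "at z" f c] by (auto simp: is_pole_def)
  then show ?thesis
    using assms Some by (simp add: to_sphere_def remove_sings_eqI)
qed (use assms in \<open>simp add: to_sphere_def is_pole_def\<close>)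

lemma sphere_lim_cong:
  assumes "sphere_lim f z w" "eventually (\<lambda>x. f x = g x) (at z)"
  shows "sphere_lim g z w"
  using assms by (cases w) (auto simp: tendsto_cong filterlim_cong)

lemma to_sphere_cong:
  assumes "eventually (\<lambda>x. f x = g x) (at z)"
  shows "to_sphere f z = to_sphere g z"
  unfolding to_sphere_def is_pole_def
  using remove_sings_cong[OF assms refl] filterlim_cong[OF refl refl assms] by metis

text \<open>Quotients of entire functions have no essential singularities, so a limit on the sphere
  always exists.\<close>

lemma sphere_lim_quotient:
  assumes "F holomorphic_on UNIV" "G holomorphic_on UNIV"
  shows "sphere_lim (\<lambda>w. F w / G w) z (to_sphere (\<lambda>w. F w / G w) z)"
proof -
  have "F analytic_on {z}" "G analytic_on {z}"
    using assms by (metis analytic_on_open analytic_on_subset open_UNIV subset_UNIV)+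
  then have "not_essential (\<lambda>w. F w / G w) z"
    by (intro not_essential_divide not_essential_analytic isolated_singularity_at_analytic)
  then obtain w where "sphere_lim (\<lambda>w. F w / G w) z w"
    unfolding not_essential_def is_pole_def by (metis sphere_lim_simps)
  then show ?thesis
    using to_sphere_eqI by metis
qed

lemma filterlim_affine_at:
  fixes a b z :: complex
  assumes "a \<noteq> 0"
  shows "filterlim (\<lambda>x. a * x + b) (at (a * z + b)) (at z)"
  unfolding filterlim_at
  using assms by (auto intro!: tendsto_intros simp: eventually_at_filter)

lemma to_sphere_affine:
  assumes "F holomorphic_on UNIV" "G holomorphic_on UNIV" "a \<noteq> 0"
  shows "to_sphere (\<lambda>x. F (a * x + b) / G (a * x + b)) z = to_sphere (\<lambda>x. F x / G x) (a * z + b)"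
proof (rule to_sphere_eqI)
  have lim: "sphere_lim (\<lambda>x. F x / G x) (a * z + b) (to_sphere (\<lambda>x. F x / G x) (a * z + b))"
    (is "sphere_lim ?f _ ?w") by (rule sphere_lim_quotient[OF assms(1,2)])
  show "sphere_lim (\<lambda>x. F (a * x + b) / G (a * x + b)) z ?w"
    using lim filterlim_compose[OF _ filterlim_affine_at[OF assms(3)], of ?f _ z b]
    by (cases ?w) auto
qed

text \<open>This is behind the value of \<open>frac_map\<close> at infinity: \<open>d\<close> may
  exceed the degree of \<open>p\<close>, and then the limit 0 is again
  \<open>coeff p d\<close>.\<close>

lemma poly_over_power_tendsto:
  fixes p :: "complex poly"
  assumes "degree p \<le> d"
  shows "((\<lambda>x. poly p x / x ^ d) \<longlongrightarrow> coeff p d) at_infinity"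
proof -
  have "((\<lambda>x. \<Sum>i\<le>degree p. coeff p i * (inverse x) ^ (d - i)) \<longlongrightarrow>
      (\<Sum>i\<le>degree p. coeff p i * 0 ^ (d - i))) at_infinity"
    by (intro tendsto_intros tendsto_inverse_0)
  also have "(\<Sum>i\<le>degree p. coeff p i * 0 ^ (d - i)) = (\<Sum>i\<le>degree p. if i = d then coeff p i else 0)"
    by (rule sum.cong) (use assms in auto)
  also have "\<dots> = coeff p d"
    using assms by (auto simp: coeff_eq_0)
  finally show ?thesis
  proof (rule Lim_transform_eventually)
    show "\<forall>\<^sub>F x in at_infinity.
        (\<Sum>i\<le>degree p. coeff p i * (inverse x) ^ (d - i)) = poly p x / x ^ d"
      using eventually_not_equal_at_infinity[of 0]
    proof eventually_elim
      case (elim x)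
      have "inverse x ^ (d - i) = x ^ i / x ^ d" if "i \<le> degree p" for i
        using elim that assms by (simp add: power_diff field_simps)
      then show ?case
        unfolding poly_altdef sum_divide_distrib by (intro sum.cong) auto
    qed
  qed
qed

text \<open>Continuity of a rational map on the sphere, tested along \<open>f\<close>. Coprimality
  excludes 0/0 at finite points, and at infinity the maximum of the degrees keeps one of the two
  coefficients nonzero. Hypothesis \<open>nz\<close> keeps the conventional value of division by
  zero away from the limit.\<close>

lemma sphere_lim_frac_map:
  assumes cop: "coprime p q" and q: "q \<noteq> 0"
    and f: "sphere_lim f z w" and nz: "eventually (\<lambda>x. poly q (f x) \<noteq> 0) (at z)"
  shows "sphere_lim (\<lambda>x. poly p (f x) / poly q (f x)) z (frac_map p q w)"
proof (cases w)
  case (Some c)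
  then have fc: "f \<midarrow>z\<rightarrow> c" using f by simp
  have lims: "(\<lambda>x. poly p (f x)) \<midarrow>z\<rightarrow> poly p c" "(\<lambda>x. poly q (f x)) \<midarrow>z\<rightarrow> poly q c"
    by (intro tendsto_intros fc)+
  show ?thesis
  proof (cases "poly q c = 0")
    case True
    then have "poly p c \<noteq> 0"
      using coprime_poly_0[OF cop] by auto
    moreover have "filterlim (\<lambda>x. poly q (f x)) (at 0) (at z)"
      using lims(2) nz True by (simp add: filterlim_at)
    ultimately show ?thesis
      using filterlim_divide_at_infinity[OF lims(1)] True Some by (simp add: frac_map_def)
  next
    case False
    then show ?thesis
      using tendsto_divide[OF lims] Some by (simp add: frac_map_def)
  qed
next
  case None
  then have f_inf: "filterlim f at_infinity (at z)" using f by simp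
  define d where "d = max (degree p) (degree q)"
  have lims: "((\<lambda>x. poly r (f x) / f x ^ d) \<longlongrightarrow> coeff r d) (at z)" if "degree r \<le> d" for r
    by (rule filterlim_compose[OF poly_over_power_tendsto[OF that] f_inf])
  note limp = lims[of p] and limq = lims[of q]
  have le: "degree p \<le> d" "degree q \<le> d" by (auto simp: d_def)
  have ev0: "eventually (\<lambda>x. f x \<noteq> 0) (at z)"
    using filterlim_at_infinity_imp_eventually_ne[OF f_inf] .
  have ev: "eventually (\<lambda>x. (poly p (f x) / f x ^ d) / (poly q (f x) / f x ^ d) =
      poly p (f x) / poly q (f x)) (at z)"
    using ev0 by eventually_elim simp
  have "sphere_lim (\<lambda>x. (poly p (f x) / f x ^ d) / (poly q (f x) / f x ^ d)) z (frac_map p q w)"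
  proof (cases "coeff q d = 0")
    case True
    have pd: "coeff p d \<noteq> 0"
    proof
      assume "coeff p d = 0"
      with True have "p = 0 \<or> d \<noteq> degree p" "d \<noteq> degree q"
        using q by auto
      then have "p = 0" unfolding d_def by linarith
      with \<open>coeff p d = 0\<close> \<open>d \<noteq> degree q\<close> show False
        unfolding d_def by simp
    qed
    have qd: "filterlim (\<lambda>x. poly q (f x) / f x ^ d) (at 0) (at z)"
      unfolding filterlim_at using limq[OF le(2)] True eventually_conj[OF nz ev0]
      by (auto elim!: eventually_mono)
    have "frac_map p q w = None"
      using True None by (simp add: frac_map_def d_def[symmetric])
    then show ?thesis
      using filterlim_divide_at_infinity[OF limp[OF le(1)] qd pd] by (simp only: sphere_lim_simps)
  next
    case False
    then show ?thesis
      using tendsto_divide[OF limp[OF le(1)] limq[OF le(2)]] None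
      by (simp add: frac_map_def d_def[symmetric])
  qed
  then show ?thesis by (rule sphere_lim_cong[OF _ ev])
qed

section \<open>Rational parametrisation by theta quotients\<close>

text \<open>\<open>F\<close> and \<open>G\<close> are homogeneous of the same degree in
  \<open>U\<close> and \<open>V\<close>, so the powers of \<open>V\<close> cancel and a rational
  function of \<open>U / V\<close> remains.\<close>

lemma theta_quotient_rational:
  assumes T: "Im T > 0" and U: "U \<in> theta_space T 1" and V: "V \<in> theta_space T 1"
    and ind: "independent_pair U V"
    and F: "F \<in> theta_space T n" and G: "G \<in> theta_space T n" "G b \<noteq> 0"
  shows "\<exists>R. rational_function R \<and>
    (\<forall>z. R (to_sphere (\<lambda>z. U z / V z) z) = to_sphere (\<lambda>z. F z / G z) z)"
proof -
  obtain v where v: "V v \<noteq> 0"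
    using independent_pairD[OF ind, of 0 1] by auto
  have "\<exists>P. \<forall>z. V z \<noteq> 0 \<longrightarrow> H z = V z ^ n * poly P (U z / V z)" if H: "H \<in> theta_space T n" for H
  proof -
    obtain c where c: "\<And>z. H z = (\<Sum>i\<le>n. c i * (U z ^ i * V z ^ (n - i)))"
      using theta_space_spanned[OF T U V ind H] by blast
    have "H z = V z ^ n * poly (\<Sum>i\<le>n. monom (c i) i) (U z / V z)" if "V z \<noteq> 0" for z
      unfolding c poly_sum sum_distrib_left
      by (rule sum.cong) (use that in \<open>auto simp: poly_monom field_simps simp flip: power_add\<close>)
    then show ?thesis by blast
  qed
  then obtain P Q where P: "\<And>z. V z \<noteq> 0 \<Longrightarrow> F z = V z ^ n * poly P (U z / V z)"
    and Q: "\<And>z. V z \<noteq> 0 \<Longrightarrow> G z = V z ^ n * poly Q (U z / V z)"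
    using F G(1) by metis
  have evV: "eventually (\<lambda>z. V z \<noteq> 0) (at z)" for z
    by (rule entire_eventually_nonzero[OF theta_spaceD(1)[OF V] v])
  have evG: "eventually (\<lambda>z. G z \<noteq> 0) (at z)" for z
    by (rule entire_eventually_nonzero[OF theta_spaceD(1)[OF G(1)] G(2)])
  \<comment> \<open>The claim does not involve \<open>z\<close>; the filter only supplies a point
    where neither \<open>V\<close> nor \<open>G\<close> vanishes.\<close>
  have "eventually (\<lambda>z. Q \<noteq> 0) (at (0 :: complex))"
    using evV evG by eventually_elim (use Q in auto)
  then have "Q \<noteq> 0" by simp
  \<comment> \<open>\<open>P\<close> and \<open>Q\<close> may share a factor, while
    \<open>frac_map\<close> induces the sphere map only for coprime polynomials. The common factor
    cancels wherever \<open>V\<close> and \<open>G\<close> do not vanish.\<close>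
  then have "gcd P Q \<noteq> 0" by simp
  from gcd_coprime_exists[OF this] obtain p q where
    pq: "P = p * gcd P Q" "Q = q * gcd P Q" "coprime p q" by blast
  have "q \<noteq> 0" using pq(2) \<open>Q \<noteq> 0\<close> by auto
  have "frac_map p q (to_sphere (\<lambda>z. U z / V z) z) = to_sphere (\<lambda>z. F z / G z) z" for z
  proof -
    have Qne: "poly Q (U z / V z) \<noteq> 0" if "V z \<noteq> 0" "G z \<noteq> 0" for z
      using Q that by auto
    have nz: "eventually (\<lambda>z. poly q (U z / V z) \<noteq> 0) (at z)"
      using evV evG
    proof eventually_elim
      case (elim z)
      then show ?case using Qne[of z] by (subst (asm) pq(2)) auto
    qed
    have ev: "eventually (\<lambda>z. poly p (U z / V z) / poly q (U z / V z) = F z / G z) (at z)"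
      using evV evG
    proof eventually_elim
      case (elim z)
      have "poly Q (U z / V z) = poly q (U z / V z) * poly (gcd P Q) (U z / V z)"
        by (subst pq(2)) simp
      moreover have "poly P (U z / V z) = poly p (U z / V z) * poly (gcd P Q) (U z / V z)"
        by (subst pq(1)) simp
      ultimately show ?case
        using Qne[OF elim] elim P[of z] Q[of z] by simp
    qed
    have "sphere_lim (\<lambda>z. U z / V z) z (to_sphere (\<lambda>z. U z / V z) z)"
      by (rule sphere_lim_quotient[OF theta_spaceD(1)[OF U] theta_spaceD(1)[OF V]])
    from sphere_lim_cong[OF sphere_lim_frac_map[OF pq(3) \<open>q \<noteq> 0\<close> this nz] ev]
    show ?thesis by (rule to_sphere_eqI[symmetric])
  qed
  then show ?thesis
    using pq(3) \<open>q \<noteq> 0\<close> unfolding rational_function_def by blast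
qed

text \<open>If the value \<open>c\<close> were omitted, \<open>1 / (U/V - c)\<close> would be a theta quotient without poles, hence constant.\<close>

lemma theta_quotient_surj:
  assumes T: "Im T > 0" and U: "U \<in> theta_space T 1" and V: "V \<in> theta_space T 1"
    and ind: "independent_pair U V"
  shows "\<exists>z. to_sphere (\<lambda>z. U z / V z) z = w"
proof (rule ccontr)
  assume omit: "\<nexists>z. to_sphere (\<lambda>z. U z / V z) z = w"
  have lim: "sphere_lim (\<lambda>z. U z / V z) z (to_sphere (\<lambda>z. U z / V z) z)" for z
    by (rule sphere_lim_quotient[OF theta_spaceD(1)[OF U] theta_spaceD(1)[OF V]])
  obtain v where v: "V v \<noteq> 0"
    using independent_pairD[OF ind, of 0 1] by auto
  show False
  proof (cases w)
    case None
    have "\<exists>c. (\<lambda>z. U z / V z) \<midarrow>z\<rightarrow> c" for z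
    proof -
      have "to_sphere (\<lambda>z. U z / V z) z \<noteq> None" using omit unfolding None by metis
      then show ?thesis using lim[of z] by auto
    qed
    then obtain c where c: "\<And>z. U z = c * V z"
      using theta_space_ratio_const[OF T U V v] by blast
    then show False
      using independent_pairD[OF ind, of 1 "- c"] by auto
  next
    case (Some c)
    let ?G = "\<lambda>z. 1 * U z + (- c) * V z"
    obtain g where g: "?G g \<noteq> 0"
      using independent_pairD[OF ind, of 1 "- c"] by auto
    have "\<exists>a. (\<lambda>z. V z / ?G z) \<midarrow>z\<rightarrow> a" for z
    proof -
      have ev: "eventually (\<lambda>z. inverse (U z / V z - c) = V z / ?G z) (at z)"
        using entire_eventually_nonzero[OF theta_spaceD(1)[OF V] v]
        by eventually_elim (auto simp: field_simps)
      have "\<exists>a. (\<lambda>z. inverse (U z / V z - c)) \<midarrow>z\<rightarrow> a"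
      proof (cases "to_sphere (\<lambda>z. U z / V z) z")
        case None
        then have "filterlim (\<lambda>z. U z / V z + (- c)) at_infinity (at z)"
          using lim[of z] by (intro tendsto_add_filterlim_at_infinity') auto
        then show ?thesis
          using filterlim_compose[OF tendsto_inverse_0] by fastforce
      next
        case (Some d)
        then have "d \<noteq> c" using omit \<open>w = Some c\<close> by auto
        then have "(\<lambda>z. inverse (U z / V z - c)) \<midarrow>z\<rightarrow> inverse (d - c)"
          using lim[of z] Some by (intro tendsto_intros) auto
        then show ?thesis ..
      qed
      then obtain a where "(\<lambda>z. inverse (U z / V z - c)) \<midarrow>z\<rightarrow> a" ..
      from Lim_transform_eventually[OF this ev] show ?thesis ..
    qed
    then obtain a where a: "\<And>z. V z = a * ?G z"
      using theta_space_ratio_const[OF T V theta_space_lincomb[OF U V] g] by metis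
    \<comment> \<open>The coefficients of \<open>V = a * (U - c * V)\<close> with all terms on one
      side; if \<open>a = 0\<close>, the second is 1.\<close>
    have "(- a, 1 + a * c) \<noteq> (0, 0)" by auto
    then obtain z where "(- a) * U z + (1 + a * c) * V z \<noteq> 0"
      by (rule independent_pairD[OF ind])
    with a[of z] show False by (simp add: algebra_simps)
  qed
qed

section \<open>The theta functions\<close>

text \<open>\<open>theta3\<close> serves as the basic function: the others are its translates by
  half periods, up to exponential factors, so convergence is settled once.\<close>

lemma theta4_eq: "theta4 z \<tau> = theta3 (z + of_real pi / 2) \<tau>"
proof -
  have "(- 1) powi m * exp (\<i> * of_real pi * \<tau> * (of_int m)\<^sup>2 + 2 * of_int m * \<i> * z) =
      exp (\<i> * of_real pi * \<tau> * (of_int m)\<^sup>2 + 2 * of_int m * \<i> * (z + of_real pi / 2))" for m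
  proof -
    have "(- 1 :: complex) powi m = exp (of_int m * (\<i> * of_real pi))"
      by (simp add: exp_power_int[symmetric] mult.commute)
    then show ?thesis
      by (simp add: algebra_simps flip: exp_add)
  qed
  then show ?thesis unfolding theta4_def theta3_def by simp
qed

lemma theta2_eq:
  "theta2 z \<tau> = exp (\<i> * of_real pi * \<tau> / 4 + \<i> * z) * theta3 (z + of_real pi * \<tau> / 2) \<tau>"
  unfolding theta2_def theta3_def infsum_cmult_right'[symmetric]
  by (rule infsum_cong) (simp add: algebra_simps power2_eq_square add_divide_distrib flip: exp_add)

lemma theta1_eq: "theta1 z \<tau> = theta2 (z - of_real pi / 2) \<tau>"
proof -
  have "- \<i> * ((- 1) powi m * exp (\<i> * of_real pi * \<tau> * (of_int m + 1/2)\<^sup>2 + (2 * of_int m + 1) * \<i> * z)) =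
      exp (\<i> * of_real pi * \<tau> * (of_int m + 1/2)\<^sup>2 + (2 * of_int m + 1) * \<i> * (z - of_real pi / 2))" for m
  proof -
    have "exp (\<i> * of_real pi * \<tau> * (of_int m + 1/2)\<^sup>2 + (2 * of_int m + 1) * \<i> * (z - of_real pi / 2)) =
        exp (\<i> * of_real pi * \<tau> * (of_int m + 1/2)\<^sup>2 + (2 * of_int m + 1) * \<i> * z) *
        exp (of_int (- m) * (\<i> * of_real pi)) * exp (- (\<i> * (of_real pi / 2)))"
      by (simp add: algebra_simps flip: exp_add)
    moreover have "exp (of_int (- m) * (\<i> * of_real pi)) = (- 1 :: complex) powi m"
      by (simp add: exp_power_int[symmetric] mult.commute exp_minus power_int_minus flip: power_int_inverse)
    moreover have "exp (- (\<i> * (of_real pi / 2))) = cis (- (pi / 2))"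
      by (simp add: cis_conv_exp)
    then have "exp (- (\<i> * (of_real pi / 2))) = - \<i>"
      by (simp add: complex_eq_iff)
    ultimately show ?thesis by simp
  qed
  then show ?thesis
    unfolding theta1_def theta2_def infsum_cmult_right'[symmetric] by simp
qed

lemma theta3_minus: "theta3 (- z) \<tau> = theta3 z \<tau>"
  unfolding theta3_def
  by (subst infsum_reindex_bij_betw[of uminus UNIV UNIV, symmetric])
     (auto intro!: bij_betwI[of _ _ _ uminus])

lemma exp_int_pi_period: "exp (2 * of_int m * \<i> * (z + of_real pi)) = exp (2 * of_int m * \<i> * z)"
proof -
  have "exp (2 * of_int m * \<i> * (z + of_real pi)) = exp (2 * of_int m * \<i> * z) * exp (\<i> * of_int m * (of_real pi * 2))"
    by (simp add: algebra_simps flip: exp_add)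
  then show ?thesis using exp_integer_2pi[of "of_int m"] by (simp add: algebra_simps)
qed

lemma theta3_pi: "theta3 (z + of_real pi) \<tau> = theta3 z \<tau>"
  unfolding theta3_def exp_add exp_int_pi_period ..

lemma theta3_tau:
  "theta3 (z + of_real pi * \<tau>) \<tau> = exp (- \<i> * of_real pi * \<tau> - 2 * \<i> * z) * theta3 z \<tau>"
proof -
  have "theta3 z \<tau> = (\<Sum>\<^sub>\<infinity>m::int.
      exp (\<i> * of_real pi * \<tau> * (of_int (m + 1))\<^sup>2 + 2 * of_int (m + 1) * \<i> * z))"
    unfolding theta3_def
    by (rule infsum_reindex_bij_betw[of "\<lambda>m. m + 1" UNIV UNIV, symmetric])
       (auto intro!: bij_betwI[of _ _ _ "\<lambda>m. m - 1"])
  then show ?thesis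
    unfolding theta3_def
    by (simp only: infsum_cmult_right'[symmetric])
       (rule infsum_cong, simp add: algebra_simps power2_eq_square flip: exp_add)
qed

section \<open>Convergence and holomorphy of the theta series\<close>

lemma summable_exp_minus_abs_int: "(\<lambda>m::int. exp (- \<bar>real_of_int m\<bar>)) summable_on UNIV"
proof -
  have "summable (\<lambda>n. norm (exp (- 1 :: real) ^ n))"
    by (auto intro!: summable_geometric)
  then have nat: "(\<lambda>n::nat. exp (- real n)) summable_on UNIV"
    by (intro norm_summable_imp_summable_on) (simp flip: exp_of_nat_mult)
  have "(\<lambda>m::int. exp (- \<bar>real_of_int m\<bar>)) summable_on range int"
    by (subst summable_on_reindex) (auto simp: o_def nat)
  moreover have "(\<lambda>m::int. exp (- \<bar>real_of_int m\<bar>)) summable_on range (\<lambda>n. - int n)"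
    by (subst summable_on_reindex) (auto simp: o_def nat inj_on_def)
  ultimately have "(\<lambda>m::int. exp (- \<bar>real_of_int m\<bar>)) summable_on (range int \<union> range (\<lambda>n. - int n))"
    by (rule summable_on_union)
  moreover have "range int \<union> range (\<lambda>n. - int n) = UNIV"
  proof -
    have "m \<in> range int \<union> range (\<lambda>n. - int n)" for m
      by (cases m rule: int_cases2) auto
    then show ?thesis by blast
  qed
  ultimately show ?thesis by simp
qed

text \<open>Completing the square in \<open>\<bar>m\<bar>\<close>.\<close>

lemma theta3_term_bound:
  assumes "Im \<tau> > 0" "norm z \<le> B"
  shows "norm (exp (\<i> * of_real pi * \<tau> * (of_int m)\<^sup>2 + 2 * of_int m * \<i> * z))
    \<le> exp ((2 * B + 1)\<^sup>2 / (4 * (pi * Im \<tau>))) * exp (- \<bar>real_of_int m\<bar>)"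
proof -
  define x where "x = \<bar>real_of_int m\<bar>"
  define a where "a = pi * Im \<tau>"
  have a: "a > 0" using assms by (simp add: a_def)
  have "Re (\<i> * of_real pi * \<tau> * (of_int m)\<^sup>2 + 2 * of_int m * \<i> * z) = - a * x\<^sup>2 - 2 * (real_of_int m * Im z)"
    by (simp add: a_def x_def power2_eq_square algebra_simps)
  also have "\<dots> \<le> - a * x\<^sup>2 + 2 * (x * B)"
  proof -
    have "\<bar>real_of_int m * Im z\<bar> \<le> x * B"
      unfolding x_def abs_mult using assms abs_Im_le_cmod[of z] by (intro mult_left_mono) auto
    then show ?thesis by linarith
  qed
  also have "\<dots> \<le> (2 * B + 1)\<^sup>2 / (4 * a) - x"
  proof -
    have "0 \<le> (2 * a * x - (2 * B + 1))\<^sup>2 / (4 * a)" using a by simp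
    also have "\<dots> = a * x\<^sup>2 - (2 * B + 1) * x + (2 * B + 1)\<^sup>2 / (4 * a)"
      using a by (simp add: power2_eq_square field_simps)
    finally show ?thesis by (simp add: algebra_simps)
  qed
  finally show ?thesis
    by (simp add: norm_exp_eq_Re x_def a_def exp_diff exp_minus field_simps flip: exp_add)
qed

lemma theta3_summable:
  assumes "Im \<tau> > 0"
  shows "(\<lambda>m::int. exp (\<i> * of_real pi * \<tau> * (of_int m)\<^sup>2 + 2 * of_int m * \<i> * z)) summable_on UNIV"
proof (rule Infinite_Sum.abs_summable_summable, rule Infinite_Sum.abs_summable_on_comparison_test')
  show "norm (exp (\<i> * of_real pi * \<tau> * (of_int m)\<^sup>2 + 2 * of_int m * \<i> * z))
    \<le> exp ((2 * norm z + 1)\<^sup>2 / (4 * (pi * Im \<tau>))) * exp (- \<bar>real_of_int m\<bar>)" for m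
    by (rule theta3_term_bound[OF assms order_refl])
qed (intro summable_on_cmult_right summable_exp_minus_abs_int)

lemma theta3_holomorphic:
  assumes "Im \<tau> > 0"
  shows "(\<lambda>z. theta3 z \<tau>) holomorphic_on UNIV"
proof -
  let ?f = "\<lambda>(m::int) z. exp (\<i> * of_real pi * \<tau> * (of_int m)\<^sup>2 + 2 * of_int m * \<i> * z)"
  have "(\<lambda>z. theta3 z \<tau>) holomorphic_on ball 0 r" for r
  proof -
    have lim: "uniform_limit (cball 0 r) (\<lambda>X z. \<Sum>m\<in>X. ?f m z) (\<lambda>z. theta3 z \<tau>) (finite_subsets_at_top UNIV)"
      unfolding theta3_def
      by (rule Weierstrass_m_test_general[OF theta3_term_bound])
         (auto intro!: summable_on_cmult_right summable_exp_minus_abs_int assms)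
    have "\<forall>\<^sub>F X in finite_subsets_at_top UNIV. continuous_on (cball 0 r) (\<lambda>z. \<Sum>m\<in>X. ?f m z) \<and>
        (\<lambda>z. \<Sum>m\<in>X. ?f m z) holomorphic_on ball 0 r"
      by (intro always_eventually allI conjI continuous_intros holomorphic_intros)
    from holomorphic_uniform_limit[OF this lim] show ?thesis by simp
  qed
  then have "(\<lambda>z. theta3 z \<tau>) holomorphic_on (\<Union>r. ball 0 r)"
    by (intro holomorphic_on_UN_open) auto
  moreover have "(\<Union>r. ball (0 :: complex) r) = UNIV"
  proof -
    have "z \<in> ball 0 (norm z + 1)" for z :: complex by simp
    then show ?thesis by blast
  qed
  ultimately show ?thesis by simp
qed

lemma theta_holomorphic [holomorphic_intros]:
  assumes "Im \<tau> > 0" "g holomorphic_on UNIV"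
  shows "(\<lambda>z. theta1 (g z) \<tau>) holomorphic_on UNIV" "(\<lambda>z. theta2 (g z) \<tau>) holomorphic_on UNIV"
    "(\<lambda>z. theta3 (g z) \<tau>) holomorphic_on UNIV" "(\<lambda>z. theta4 (g z) \<tau>) holomorphic_on UNIV"
proof -
  note comp = entire_compose[OF theta3_holomorphic[OF assms(1)]]
  show "(\<lambda>z. theta3 (g z) \<tau>) holomorphic_on UNIV"
    by (rule comp[OF assms(2)])
  show "(\<lambda>z. theta4 (g z) \<tau>) holomorphic_on UNIV"
    unfolding theta4_eq by (rule comp) (intro holomorphic_intros assms)
  show "(\<lambda>z. theta2 (g z) \<tau>) holomorphic_on UNIV"
    unfolding theta2_eq by (rule holomorphic_on_mult[OF _ comp]) (intro holomorphic_intros assms)+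
  show "(\<lambda>z. theta1 (g z) \<tau>) holomorphic_on UNIV"
    unfolding theta1_eq theta2_eq by (rule holomorphic_on_mult[OF _ comp]) (intro holomorphic_intros assms)+
qed

section \<open>Symmetries and multipliers of the other theta functions\<close>

lemma theta2_minus: "theta2 (- z) \<tau> = theta2 z \<tau>"
  unfolding theta2_def
  by (subst infsum_reindex_bij_betw[of "\<lambda>m. - m - 1" UNIV UNIV, symmetric])
     (auto intro!: bij_betwI[of _ _ _ "\<lambda>m. - m - 1"] infsum_cong simp: power2_eq_square algebra_simps)

lemma theta2_pi: "theta2 (z + of_real pi) \<tau> = - theta2 z \<tau>"
  unfolding theta2_eq
  using theta3_pi[of "z + of_real pi * \<tau> / 2" \<tau>] by (simp add: exp_add algebra_simps)

lemma theta2_tau: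
  "theta2 (z + of_real pi * \<tau>) \<tau> = exp (- \<i> * of_real pi * \<tau> - 2 * \<i> * z) * theta2 z \<tau>"
  unfolding theta2_eq
  using theta3_tau[of "z + of_real pi * \<tau> / 2" \<tau>] by (simp add: algebra_simps flip: exp_add)

lemma theta4_minus: "theta4 (- z) \<tau> = theta4 z \<tau>"
  using theta3_minus[of "z - of_real pi / 2" \<tau>] theta3_pi[of "z - of_real pi / 2" \<tau>]
  unfolding theta4_eq by (simp add: algebra_simps)

lemma theta4_pi: "theta4 (z + of_real pi) \<tau> = theta4 z \<tau>"
  unfolding theta4_eq using theta3_pi[of "z + of_real pi / 2" \<tau>] by (simp add: algebra_simps)

lemma exp_minus_pi_i: "exp (z - \<i> * of_real pi) = - exp z" "exp (z + \<i> * of_real pi) = - exp z"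
  using exp_pi_i by (simp_all add: exp_diff exp_add mult.commute)

lemma theta4_tau:
  "theta4 (z + of_real pi * \<tau>) \<tau> = - exp (- \<i> * of_real pi * \<tau> - 2 * \<i> * z) * theta4 z \<tau>"
proof -
  have "- \<i> * of_real pi * \<tau> - 2 * \<i> * (z + of_real pi / 2) =
      - \<i> * of_real pi * \<tau> - 2 * \<i> * z - \<i> * of_real pi" by (simp add: algebra_simps)
  then have "exp (- \<i> * of_real pi * \<tau> - 2 * \<i> * (z + of_real pi / 2)) =
      - exp (- \<i> * of_real pi * \<tau> - 2 * \<i> * z)" by (simp only: exp_minus_pi_i)
  moreover have "z + of_real pi * \<tau> + of_real pi / 2 = z + of_real pi / 2 + of_real pi * \<tau>" by simp
  ultimately show ?thesis
    unfolding theta4_eq by (simp only: theta3_tau)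
qed

lemma theta1_pi: "theta1 (z + of_real pi) \<tau> = - theta1 z \<tau>"
  unfolding theta1_eq using theta2_pi[of "z - of_real pi / 2" \<tau>] by (simp add: algebra_simps)

lemma theta1_minus: "theta1 (- z) \<tau> = - theta1 z \<tau>"
  using theta2_minus[of "z + of_real pi / 2" \<tau>] theta2_pi[of "z - of_real pi / 2" \<tau>]
  unfolding theta1_eq by (simp add: algebra_simps)

lemma theta1_tau:
  "theta1 (z + of_real pi * \<tau>) \<tau> = - exp (- \<i> * of_real pi * \<tau> - 2 * \<i> * z) * theta1 z \<tau>"
proof -
  have "- \<i> * of_real pi * \<tau> - 2 * \<i> * (z - of_real pi / 2) =
      - \<i> * of_real pi * \<tau> - 2 * \<i> * z + \<i> * of_real pi" by (simp add: algebra_simps)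
  then have "exp (- \<i> * of_real pi * \<tau> - 2 * \<i> * (z - of_real pi / 2)) =
      - exp (- \<i> * of_real pi * \<tau> - 2 * \<i> * z)" by (simp only: exp_minus_pi_i)
  moreover have "z + of_real pi * \<tau> - of_real pi / 2 = z - of_real pi / 2 + of_real pi * \<tau>" by simp
  ultimately show ?thesis
    unfolding theta1_eq by (simp only: theta2_tau)
qed

text \<open>Iterating the shift adds up the odd numbers 2j + 1 for j < n. Their sum n^2 is n times
  the n in the modulus \<open>of_nat n * \<tau>\<close>, as the n-th power of the multiplier
  requires.\<close>

lemma theta_isogeny_multiplier:
  fixes f :: "complex \<Rightarrow> complex"
  assumes "\<And>z. f (z + of_real pi * \<tau>) = - exp (- \<i> * of_real pi * \<tau> - 2 * \<i> * z) * f z"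
  shows "f (z + of_real pi * (of_nat n * \<tau>)) =
    (- exp (- \<i> * of_real pi * (of_nat n * \<tau>) - 2 * \<i> * z)) ^ n * f z"
proof -
  have "f (z + of_real pi * (of_nat n * \<tau>)) =
      (- 1) ^ n * exp (- \<i> * of_real pi * \<tau> * (of_nat n)\<^sup>2 - 2 * of_nat n * \<i> * z) * f z"
  proof (induction n)
    case (Suc n)
    have "f (z + of_real pi * (of_nat (Suc n) * \<tau>)) = f ((z + of_real pi * (of_nat n * \<tau>)) + of_real pi * \<tau>)"
      by (simp add: algebra_simps)
    also have "\<dots> = - exp (- \<i> * of_real pi * \<tau> - 2 * \<i> * (z + of_real pi * (of_nat n * \<tau>))) *
        ((- 1) ^ n * exp (- \<i> * of_real pi * \<tau> * (of_nat n)\<^sup>2 - 2 * of_nat n * \<i> * z) * f z)"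
      unfolding assms Suc ..
    also have "\<dots> = (- 1) ^ Suc n * (exp (- \<i> * of_real pi * \<tau> - 2 * \<i> * (z + of_real pi * (of_nat n * \<tau>))) *
        exp (- \<i> * of_real pi * \<tau> * (of_nat n)\<^sup>2 - 2 * of_nat n * \<i> * z)) * f z"
      by simp
    also have "exp (- \<i> * of_real pi * \<tau> - 2 * \<i> * (z + of_real pi * (of_nat n * \<tau>))) *
        exp (- \<i> * of_real pi * \<tau> * (of_nat n)\<^sup>2 - 2 * of_nat n * \<i> * z) =
        exp (- \<i> * of_real pi * \<tau> * (of_nat (Suc n))\<^sup>2 - 2 * of_nat (Suc n) * \<i> * z)"
      unfolding exp_add[symmetric]
      by (rule arg_cong[where f = exp]) (simp add: algebra_simps power2_eq_square)
    finally show ?case .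
  qed simp
  moreover have "(- exp (- \<i> * of_real pi * (of_nat n * \<tau>) - 2 * \<i> * z)) ^ n =
      (- 1) ^ n * exp (- \<i> * of_real pi * \<tau> * (of_nat n)\<^sup>2 - 2 * of_nat n * \<i> * z)"
    unfolding power_minus[of "exp _"] exp_of_nat_mult[symmetric]
    by (simp add: algebra_simps power2_eq_square)
  ultimately show ?thesis by simp
qed

lemma theta_in_theta_space:
  assumes "Im \<tau> > 0"
  shows "(\<lambda>z. theta1 z \<tau>) \<in> theta_space (of_nat n * \<tau>) n"
    and "(\<lambda>z. theta4 z \<tau>) \<in> theta_space (of_nat n * \<tau>) n"
proof -
  have "z + of_real (2 * pi) = z + of_real pi + of_real pi" for z :: complex by simp
  then have "theta1 (z + of_real (2 * pi)) \<tau> = theta1 z \<tau>" "theta4 (z + of_real (2 * pi)) \<tau> = theta4 z \<tau>" for z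
    by (simp_all only: theta1_pi theta4_pi minus_minus)
  moreover have "theta1 (of_real pi - z) \<tau> = theta1 z \<tau>" "theta4 (of_real pi - z) \<tau> = theta4 z \<tau>" for z
    using theta1_pi[of "- z" \<tau>] theta4_pi[of "- z" \<tau>]
    by (simp_all add: theta1_minus theta4_minus add.commute)
  moreover note theta_isogeny_multiplier[of "\<lambda>z. theta1 z \<tau>", OF theta1_tau]
    theta_isogeny_multiplier[of "\<lambda>z. theta4 z \<tau>", OF theta4_tau]
  ultimately show "(\<lambda>z. theta1 z \<tau>) \<in> theta_space (of_nat n * \<tau>) n"
    "(\<lambda>z. theta4 z \<tau>) \<in> theta_space (of_nat n * \<tau>) n"
    unfolding theta_space_def using assms
    by (auto intro!: holomorphic_intros simp del: of_real_mult)
qed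

text \<open>The series for \<tau>/4 is split by parity: even indices give \<open>theta3\<close>, odd
  ones \<open>theta2\<close>.\<close>

lemma theta_add_sub:
  assumes "Im \<tau> > 0"
  shows "theta3 z \<tau> + theta2 z \<tau> = theta3 (z / 2) (\<tau> / 4)"
    and "theta3 z \<tau> - theta2 z \<tau> = theta4 (z / 2) (\<tau> / 4)"
proof -
  have add: "theta3 z \<tau> + theta2 z \<tau> = theta3 (z / 2) (\<tau> / 4)" for z
  proof -
    let ?f = "\<lambda>m::int. exp (\<i> * of_real pi * (\<tau> / 4) * (of_int m)\<^sup>2 + 2 * of_int m * \<i> * (z / 2))"
    have sum: "?f summable_on A" for A
      using theta3_summable[of "\<tau> / 4" "z / 2"] assms by (auto intro: summable_on_subset_banach)
    have "infsum ?f (range (\<lambda>m. 2 * m) \<union> range (\<lambda>m. 2 * m + 1)) =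
        infsum ?f (range (\<lambda>m. 2 * m)) + infsum ?f (range (\<lambda>m. 2 * m + 1))"
      by (rule infsum_Un_disjoint[OF sum sum]) (auto, presburger)
    also have "range (\<lambda>m. 2 * m) \<union> range (\<lambda>m. 2 * m + 1) = (UNIV :: int set)"
      by (auto simp: image_iff) presburger
    also have "infsum ?f (range (\<lambda>m. 2 * m)) = theta3 z \<tau>"
      unfolding theta3_def
      by (subst infsum_reindex) (auto simp: inj_on_def o_def power2_eq_square mult.assoc intro!: infsum_cong)
    also have "infsum ?f (range (\<lambda>m. 2 * m + 1)) = theta2 z \<tau>"
    proof -
      have half: "(of_int m + 1/2 :: complex)\<^sup>2 = (2 * of_int m + 1)\<^sup>2 / 4" for m
      proof -
        have "2 * of_int m + 1 = 2 * (of_int m + 1/2 :: complex)" by (simp add: distrib_left)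
        then show ?thesis by (simp only: power_mult_distrib) simp
      qed
      have inj: "inj (\<lambda>m::int. 2 * m + 1)" by (auto simp: inj_on_def)
      have "infsum ?f (range (\<lambda>m. 2 * m + 1)) = (\<Sum>\<^sub>\<infinity>m. ?f (2 * m + 1))"
        unfolding infsum_reindex[OF inj] o_def ..
      also have "\<dots> = theta2 z \<tau>"
      proof -
        have "\<i> * of_real pi * (\<tau> / 4) * x\<^sup>2 + 2 * x * \<i> * (z / 2) =
            \<i> * of_real pi * \<tau> * (x\<^sup>2 / 4) + x * \<i> * z" for x
          by simp
        from this[of "2 * of_int _ + 1"] show ?thesis
          unfolding theta2_def half by (simp only: of_int_add of_int_mult of_int_numeral of_int_1)
      qed
      finally show ?thesis .
    qed
    finally show ?thesis unfolding theta3_def by simp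
  qed
  show "theta3 z \<tau> + theta2 z \<tau> = theta3 (z / 2) (\<tau> / 4)" by (rule add)
  \<comment> \<open>A shift by pi fixes \<open>theta3\<close> and flips the sign of
    \<open>theta2\<close>; the halved argument moves by pi/2, which turns \<open>theta3\<close> into
    \<open>theta4\<close>.\<close>
  have "theta3 (z + of_real pi) \<tau> + theta2 (z + of_real pi) \<tau> = theta3 ((z + of_real pi) / 2) (\<tau> / 4)"
    by (rule add)
  then show "theta3 z \<tau> - theta2 z \<tau> = theta4 (z / 2) (\<tau> / 4)"
    unfolding theta3_pi theta2_pi theta4_eq by (simp add: add_divide_distrib)
qed

text \<open>For imaginary \<tau> and z every term of the series is a positive real number.\<close>

lemma theta3_nonzero:
  assumes "Re \<tau> = 0" "Im \<tau> > 0" "Re z = 0"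
  shows "theta3 z \<tau> \<noteq> 0"
proof
  let ?f = "\<lambda>m::int. exp (\<i> * of_real pi * \<tau> * (of_int m)\<^sup>2 + 2 * of_int m * \<i> * z)"
  assume "theta3 z \<tau> = 0"
  note sum = theta3_summable[OF assms(2), of z]
  have pos: "Re (?f m) > 0" for m
    using assms by (simp add: Re_exp power2_eq_square)
  have "Re (?f 0) = 0"
  proof (rule nonneg_infsum_le_0D[of "\<lambda>m. Re (?f m)" UNIV])
    show "infsum (\<lambda>m. Re (?f m)) UNIV \<le> 0"
      using infsum_Re[OF sum] \<open>theta3 z \<tau> = 0\<close> by (simp add: theta3_def)
  qed (use summable_on_Re[OF sum] pos in \<open>auto intro: less_imp_le\<close>)
  with pos[of 0] show False by simp
qed

lemma theta2_0_nonzero: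
  assumes "Re \<tau> = 0" "Im \<tau> > 0"
  shows "theta2 0 \<tau> \<noteq> 0"
  using theta3_nonzero[OF assms, of "of_real pi * \<tau> / 2"] assms unfolding theta2_eq by simp

lemma theta_half_pi:
  "theta1 (of_real pi / 2) \<tau> = theta2 0 \<tau>" "theta1 (- (of_real pi / 2)) \<tau> = - theta2 0 \<tau>"
  "theta4 (of_real pi / 2) \<tau> = theta3 0 \<tau>" "theta4 (- (of_real pi / 2)) \<tau> = theta3 0 \<tau>"
  using theta3_pi[of 0 \<tau>] unfolding theta1_minus theta4_minus by (simp_all add: theta1_eq theta4_eq)

text \<open>One function is odd, the other even, and neither vanishes at pi/2; evaluation at both
  signs separates them.\<close>

lemma independent_pair_theta:
  assumes "Re \<tau> = 0" "Im \<tau> > 0"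
  shows "independent_pair (\<lambda>z. theta1 z \<tau>) (\<lambda>z. theta4 z \<tau>)"
  unfolding independent_pair_def
proof (intro allI impI)
  fix a b
  assume *: "\<forall>z. a * theta1 z \<tau> + b * theta4 z \<tau> = 0"
  note nz = theta3_nonzero[OF assms, of 0] theta2_0_nonzero[OF assms]
  have "a * theta2 0 \<tau> + b * theta3 0 \<tau> = 0" "- (a * theta2 0 \<tau>) + b * theta3 0 \<tau> = 0"
    using *[rule_format, of "of_real pi / 2"] *[rule_format, of "- (of_real pi / 2)"]
    by (simp_all only: theta_half_pi mult_minus_right)
  then have "2 * (b * theta3 0 \<tau>) = 0" by algebra
  then have "b = 0" using nz by simp
  then show "a = 0 \<and> b = 0"
    using \<open>a * theta2 0 \<tau> + b * theta3 0 \<tau> = 0\<close> nz by simp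
qed

lemma independent_pair_lincomb:
  assumes ind: "independent_pair U V" and det: "p * s - q * r \<noteq> 0"
  shows "independent_pair (\<lambda>z. p * U z + q * V z) (\<lambda>z. r * U z + s * V z)"
  unfolding independent_pair_def
proof (intro allI impI)
  fix a b
  assume "\<forall>z. a * (p * U z + q * V z) + b * (r * U z + s * V z) = 0"
  then have "\<forall>z. (a * p + b * r) * U z + (a * q + b * s) * V z = 0"
    by (simp add: algebra_simps)
  then have "a * p + b * r = 0" "a * q + b * s = 0"
    using ind unfolding independent_pair_def by blast+
  then have "a * (p * s - q * r) = 0" "b * (p * s - q * r) = 0" by algebra+
  then show "a = 0 \<and> b = 0" using det by simp
qed

section \<open>The imaginary transformation\<close>

text \<open>Period pi kills the odd coefficients and the quasi-period joins all even ones, so such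
  functions form a space of dimension at most one. Unlike in \<open>theta_space\<close>, the
  multiplier carries no sign: this is the type of \<open>theta3\<close>.\<close>

lemma quasi_periodic_determined:
  assumes hol: "f holomorphic_on UNIV" and pi: "\<And>z. f (z + of_real pi) = f z"
    and tau: "\<And>z. f (z + of_real pi * \<tau>) = exp (- \<i> * of_real pi * \<tau> - 2 * \<i> * z) * f z"
    and zero: "fourier_coeff f 0 = 0"
  shows "f z = 0"
proof -
  have per: "f (z + of_real (2 * pi)) = f z" for z
    using pi[of z] pi[of "z + of_real pi"] by (simp add: add_ac)
  note shift = fourier_coeff_shift[OF hol per]
  have step: "fourier_coeff f (m + 2) = 0 \<longleftrightarrow> fourier_coeff f m = 0" for m
  proof -
    let ?g = "\<lambda>z. exp (\<i> * of_int (- 2) * z) * f z"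
    have fg: "f (z + of_real pi * \<tau>) = exp (- \<i> * of_real pi * \<tau>) * ?g z + 0 * ?g z" for z
    proof -
      have "exp (- \<i> * of_real pi * \<tau> - 2 * \<i> * z) =
          exp (- \<i> * of_real pi * \<tau>) * exp (\<i> * of_int (- 2) * z)"
        unfolding exp_add[symmetric] by (rule arg_cong[where f = exp]) simp
      then show ?thesis
        unfolding tau by (simp only: mult.assoc mult_zero_left add_0_right)
    qed
    have "?g holomorphic_on UNIV"
      by (intro holomorphic_intros hol)
    from fourier_coeff_lincomb[OF this this, of "exp (- \<i> * of_real pi * \<tau>)" 0 m]
    have "fourier_coeff (\<lambda>z. f (z + of_real pi * \<tau>)) m =
        exp (- \<i> * of_real pi * \<tau>) * fourier_coeff f (m + 2)"
      unfolding fg fourier_coeff_mult_exp by simp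
    with shift[of "of_real pi * \<tau>" m] show ?thesis by auto
  qed
  have even_pos: "fourier_coeff f (2 * int n) = 0" for n
  proof (induction n)
    case (Suc n)
    then show ?case using step[of "2 * int n"] by (simp add: algebra_simps)
  qed (use zero in simp)
  have even_neg: "fourier_coeff f (- (2 * int n)) = 0" for n
  proof (induction n)
    case (Suc n)
    have "- (2 * int (Suc n)) + 2 = - (2 * int n)" by simp
    then show ?case using step[of "- (2 * int (Suc n))"] Suc by simp
  qed (use zero in simp)
  have even: "fourier_coeff f (2 * k) = 0" for k
    using even_pos even_neg by (cases k rule: int_cases2) auto
  have odd: "fourier_coeff f (2 * k + 1) = 0" for k
  proof -
    have "exp (\<i> * of_int (2 * k + 1) * of_real pi) = exp (\<i> * of_real pi) * exp (\<i> * of_int k * (of_real pi * 2))"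
      by (simp add: algebra_simps flip: exp_add)
    also have "\<dots> = - 1"
      using exp_integer_2pi[of "of_int k"] exp_pi_i by (simp add: mult_ac)
    finally have "fourier_coeff f (2 * k + 1) = - fourier_coeff f (2 * k + 1)"
      using shift[of "of_real pi" "2 * k + 1"] by (simp only: pi) simp
    then show ?thesis by simp
  qed
  have "fourier_coeff f m = 0" for m
    using even odd by (cases "even m") (auto elim!: evenE oddE)
  then show ?thesis
    by (rule fourier_coeffs_0_imp_0[OF hol per])
qed

text \<open>With \<rho> = -1/\<sigma>, adding pi to w subtracts pi \<rho> from w/\<sigma>, and
  adding pi \<sigma> adds pi: the periods trade places. The Gaussian \<open>E\<close> repairs the
  multipliers, and one-dimensionality makes the two functions proportional. No Poisson summation
  enters, as \<open>C\<close> is not evaluated.\<close>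

lemma theta3_imaginary_transformation:
  assumes \<sigma>: "Re \<sigma> = 0" "Im \<sigma> > 0"
  obtains C where "C \<noteq> 0" "\<And>w. theta3 (w / \<sigma>) (- 1 / \<sigma>) = C * exp (\<i> * w\<^sup>2 / (of_real pi * \<sigma>)) * theta3 w \<sigma>"
proof -
  have "\<sigma> \<noteq> 0" using \<sigma> by auto
  define \<rho> where "\<rho> = - 1 / \<sigma>"
  have \<rho>: "Re \<rho> = 0" "Im \<rho> > 0"
    using \<sigma> by (auto simp: \<rho>_def Re_divide Im_divide power2_eq_square)
  define E where "E = (\<lambda>w. exp (- \<i> * w\<^sup>2 / (of_real pi * \<sigma>)))"
  define g where "g = (\<lambda>w. E w * theta3 (w / \<sigma>) \<rho>)"
  have hol: "g holomorphic_on UNIV"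
    unfolding g_def E_def using \<open>\<sigma> \<noteq> 0\<close> \<rho> by (intro holomorphic_intros) auto
  have g_pi: "g (w + of_real pi) = g w" for w
  proof -
    have "theta3 (w / \<sigma>) \<rho> = exp (- \<i> * of_real pi * \<rho> - 2 * \<i> * ((w + of_real pi) / \<sigma>)) * theta3 ((w + of_real pi) / \<sigma>) \<rho>"
      using theta3_tau[of "(w + of_real pi) / \<sigma>" \<rho>] by (simp add: \<rho>_def add_divide_distrib)
    then have "g w = E w * exp (- \<i> * of_real pi * \<rho> - 2 * \<i> * ((w + of_real pi) / \<sigma>)) * theta3 ((w + of_real pi) / \<sigma>) \<rho>"
      by (simp add: g_def)
    also have "E w * exp (- \<i> * of_real pi * \<rho> - 2 * \<i> * ((w + of_real pi) / \<sigma>)) = E (w + of_real pi)"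
      unfolding E_def exp_add[symmetric] using \<open>\<sigma> \<noteq> 0\<close>
      by (intro arg_cong[where f = exp]) (simp add: \<rho>_def power2_eq_square field_simps)
    finally show ?thesis by (simp add: g_def)
  qed
  have g_tau: "g (w + of_real pi * \<sigma>) = exp (- \<i> * of_real pi * \<sigma> - 2 * \<i> * w) * g w" for w
  proof -
    have "theta3 ((w + of_real pi * \<sigma>) / \<sigma>) \<rho> = theta3 (w / \<sigma>) \<rho>"
      using theta3_pi[of "w / \<sigma>" \<rho>] \<open>\<sigma> \<noteq> 0\<close> by (simp add: add_divide_distrib)
    moreover have "E (w + of_real pi * \<sigma>) = exp (- \<i> * of_real pi * \<sigma> - 2 * \<i> * w) * E w"
      unfolding E_def exp_add[symmetric] using \<open>\<sigma> \<noteq> 0\<close>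
      by (intro arg_cong[where f = exp]) (simp add: power2_eq_square field_simps)
    ultimately show ?thesis by (simp add: g_def)
  qed
  define a where "a = fourier_coeff g 0"
  define b where "b = fourier_coeff (\<lambda>w. theta3 w \<sigma>) 0"
  have hol3: "(\<lambda>w. theta3 w \<sigma>) holomorphic_on UNIV" by (rule theta3_holomorphic[OF \<sigma>(2)])
  have "b \<noteq> 0"
    using quasi_periodic_determined[OF hol3 theta3_pi theta3_tau, of 0] theta3_nonzero[OF \<sigma>, of 0]
    by (auto simp: b_def)
  have "g 0 \<noteq> 0" using theta3_nonzero[OF \<rho>, of 0] by (simp add: g_def E_def)
  then have "a \<noteq> 0"
    using quasi_periodic_determined[OF hol g_pi g_tau, of 0] by (auto simp: a_def)
  \<comment> \<open>The combination is chosen to have vanishing coefficient of index 0.\<close>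
  have rel: "b * g w + (- a) * theta3 w \<sigma> = 0" for w
  proof (rule quasi_periodic_determined[where \<tau> = \<sigma> and f = "\<lambda>w. b * g w + (- a) * theta3 w \<sigma>"])
    show "(\<lambda>w. b * g w + (- a) * theta3 w \<sigma>) holomorphic_on UNIV"
      by (intro holomorphic_intros hol \<sigma>)
    show "b * g (w + of_real pi) + (- a) * theta3 (w + of_real pi) \<sigma> = b * g w + (- a) * theta3 w \<sigma>" for w
      by (simp add: g_pi theta3_pi)
    show "b * g (w + of_real pi * \<sigma>) + (- a) * theta3 (w + of_real pi * \<sigma>) \<sigma> =
        exp (- \<i> * of_real pi * \<sigma> - 2 * \<i> * w) * (b * g w + (- a) * theta3 w \<sigma>)" for w
      unfolding g_tau theta3_tau by (simp add: algebra_simps)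
    show "fourier_coeff (\<lambda>w. b * g w + (- a) * theta3 w \<sigma>) 0 = 0"
      unfolding fourier_coeff_lincomb[OF hol hol3] a_def b_def by simp
  qed
  show thesis
  proof (rule that[of "a / b"])
    show "a / b \<noteq> 0" using \<open>a \<noteq> 0\<close> \<open>b \<noteq> 0\<close> by simp
    fix w
    have "theta3 (w / \<sigma>) \<rho> = exp (\<i> * w\<^sup>2 / (of_real pi * \<sigma>)) * g w"
      by (simp add: g_def E_def exp_minus)
    also have "g w = a / b * theta3 w \<sigma>"
      using rel[of w] \<open>b \<noteq> 0\<close> by (simp add: field_simps)
    finally show "theta3 (w / \<sigma>) (- 1 / \<sigma>) = a / b * exp (\<i> * w\<^sup>2 / (of_real pi * \<sigma>)) * theta3 w \<sigma>"
      by (simp add: \<rho>_def)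
  qed
qed

text \<open>The second identity is the first at w + pi \<sigma>/2. The factor \<open>D\<close> is
  common to both, so it drops out of quotients.\<close>

lemma theta34_imaginary_transformation:
  assumes \<sigma>: "Re \<sigma> = 0" "Im \<sigma> > 0"
  obtains D where "\<And>w. D w \<noteq> 0" "\<And>w. theta3 (w / \<sigma>) (- 1 / \<sigma>) = D w * theta3 w \<sigma>"
    "\<And>w. theta4 (w / \<sigma>) (- 1 / \<sigma>) = D w * theta2 w \<sigma>"
proof -
  have "\<sigma> \<noteq> 0" using \<sigma> by auto
  obtain C where C: "C \<noteq> 0"
    "\<And>w. theta3 (w / \<sigma>) (- 1 / \<sigma>) = C * exp (\<i> * w\<^sup>2 / (of_real pi * \<sigma>)) * theta3 w \<sigma>"
    using theta3_imaginary_transformation[OF \<sigma>] by blast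
  have "theta4 (w / \<sigma>) (- 1 / \<sigma>) = C * exp (\<i> * w\<^sup>2 / (of_real pi * \<sigma>)) * theta2 w \<sigma>" for w
  proof -
    have "theta4 (w / \<sigma>) (- 1 / \<sigma>) = theta3 ((w + of_real pi * \<sigma> / 2) / \<sigma>) (- 1 / \<sigma>)"
      using \<open>\<sigma> \<noteq> 0\<close> by (simp add: theta4_eq add_divide_distrib)
    also have "\<dots> = C * exp (\<i> * (w + of_real pi * \<sigma> / 2)\<^sup>2 / (of_real pi * \<sigma>)) * theta3 (w + of_real pi * \<sigma> / 2) \<sigma>"
      by (rule C(2))
    also have "\<i> * (w + of_real pi * \<sigma> / 2)\<^sup>2 / (of_real pi * \<sigma>) =
        \<i> * w\<^sup>2 / (of_real pi * \<sigma>) + (\<i> * of_real pi * \<sigma> / 4 + \<i> * w)"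
    proof -
      \<comment> \<open>Used with a = pi \<sigma>/2; the terms beyond \<open>w\<^sup>2\<close> are
        precisely the exponent in \<open>theta2_eq\<close>.\<close>
      have "\<i> * (w + a)\<^sup>2 / (2 * a) = \<i> * w\<^sup>2 / (2 * a) + (\<i> * a / 2 + \<i> * w)" if "a \<noteq> 0" for a
        using that by (simp add: power2_eq_square field_simps)
      from this[of "of_real pi * \<sigma> / 2"] show ?thesis
        using \<open>\<sigma> \<noteq> 0\<close> by simp
    qed
    finally show ?thesis
      unfolding theta2_eq exp_add by simp
  qed
  from that[of "\<lambda>w. C * exp (\<i> * w\<^sup>2 / (of_real pi * \<sigma>))", OF _ C(2) this] C(1)
  show thesis by simp
qed

lemma imag_axis_neg_inverse:
  assumes "Re \<sigma> = 0" "Im \<sigma> > 0" "c > 0"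
  shows "Re (- of_real c / \<sigma>) = 0" "Im (- of_real c / \<sigma>) > 0"
  using assms by (auto simp: Re_divide Im_divide power2_eq_square)

text \<open>The terms of this series alternate in sign, so positivity is used after passing to
  \<open>theta2\<close> at -1/\<tau>.\<close>

lemma theta4_0_nonzero:
  assumes "Re \<tau> = 0" "Im \<tau> > 0"
  shows "theta4 0 \<tau> \<noteq> 0"
proof -
  define \<rho> where "\<rho> = - 1 / \<tau>"
  have \<rho>: "Re \<rho> = 0" "Im \<rho> > 0"
    unfolding \<rho>_def using imag_axis_neg_inverse[OF assms, of 1] by simp_all
  obtain D where D: "\<And>w. D w \<noteq> 0" "\<And>w. theta3 (w / \<rho>) (- 1 / \<rho>) = D w * theta3 w \<rho>"
    "\<And>w. theta4 (w / \<rho>) (- 1 / \<rho>) = D w * theta2 w \<rho>"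
    using theta34_imaginary_transformation[OF \<rho>] by metis
  have inv: "- 1 / \<rho> = \<tau>" unfolding \<rho>_def by simp
  have "theta4 0 \<tau> = D 0 * theta2 0 \<rho>"
    using D(3)[of 0] unfolding inv div_0 .
  then show ?thesis
    using D(1)[of 0] theta2_0_nonzero[OF \<rho>] by simp
qed

text \<open>The shift by pi/2 turns \<open>theta4\<close>, \<open>theta1\<close> into
  \<open>theta3\<close>, \<open>theta2\<close>. Their difference and sum live at modulus -1/\<sigma>
  and half the argument, where the imaginary transformation applies.\<close>

lemma theta_quotient_half_argument:
  assumes \<sigma>: "Re \<sigma> = 0" "Im \<sigma> > 0"
  defines "z w \<equiv> 2 * w / \<sigma> + of_real pi / 2"
  shows "(theta4 (z w) (- 4 / \<sigma>) - theta1 (z w) (- 4 / \<sigma>)) / (theta4 (z w) (- 4 / \<sigma>) + theta1 (z w) (- 4 / \<sigma>)) =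
    theta2 w \<sigma> / theta3 w \<sigma>"
proof -
  obtain D where D: "\<And>w. D w \<noteq> 0" "\<And>w. theta3 (w / \<sigma>) (- 1 / \<sigma>) = D w * theta3 w \<sigma>"
    "\<And>w. theta4 (w / \<sigma>) (- 1 / \<sigma>) = D w * theta2 w \<sigma>"
    using theta34_imaginary_transformation[OF \<sigma>] by metis
  have im: "Im (- 4 / \<sigma>) > 0"
    using imag_axis_neg_inverse[OF \<sigma>, of 4] by simp
  have e: "theta4 (z w) (- 4 / \<sigma>) = theta3 (2 * w / \<sigma>) (- 4 / \<sigma>)"
    "theta1 (z w) (- 4 / \<sigma>) = theta2 (2 * w / \<sigma>) (- 4 / \<sigma>)"
    unfolding theta4_eq theta1_eq z_def using theta3_pi[of "2 * w / \<sigma>"] by (simp_all add: add.assoc)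
  have scale: "2 * w / \<sigma> / 2 = w / \<sigma>" "- 4 / \<sigma> / 4 = - 1 / \<sigma>" by simp_all
  note add_sub = theta_add_sub[OF im, of "2 * w / \<sigma>", unfolded scale D(2,3)]
  show ?thesis
    unfolding e add_sub using D(1)[of w] by (rule mult_divide_mult_cancel_left)
qed

section \<open>The parametrisations\<close>

lemma x_param_eq:
  assumes "Re \<tau> = 0" "Im \<tau> > 0"
  shows "x_param \<tau> u =
    to_sphere (\<lambda>z. (theta3 0 \<tau> * theta1 z \<tau>) / (theta2 0 \<tau> * theta4 z \<tau>)) (of_real pi / 2 * u)"
proof -
  have "ellK \<tau> \<noteq> 0"
    using theta3_nonzero[OF assms, of 0] by (simp add: ellK_def)
  \<comment> \<open>The summand 0 fits the affine form in \<open>to_sphere_affine\<close>.\<close>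
  then have z: "of_real pi * (ellK \<tau> * u) / (2 * ellK \<tau>) = of_real pi / 2 * u + 0" for u
    by simp
  have "x_param \<tau> u = to_sphere (\<lambda>u. (theta3 0 \<tau> * theta1 (of_real pi / 2 * u + 0) \<tau>) /
      (theta2 0 \<tau> * theta4 (of_real pi / 2 * u + 0) \<tau>)) u"
    unfolding x_param_def jacobi_sn_def Let_def z by (simp only: times_divide_times_eq)
  also have "\<dots> = to_sphere (\<lambda>z. (theta3 0 \<tau> * theta1 z \<tau>) / (theta2 0 \<tau> * theta4 z \<tau>))
      (of_real pi / 2 * u + 0)"
    by (rule to_sphere_affine) (use assms in \<open>auto intro!: holomorphic_intros\<close>)
  finally show ?thesis by simp
qed

text \<open>All theta constants cancel, leaving \<open>theta2 / theta3\<close> of modulus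
  \<open>m * \<tau>\<close>. The common denominator \<open>theta4\<close> of cn and dn cancels only
  off its zeros, hence the detour through \<open>to_sphere_cong\<close>.\<close>

lemma y_param_eq:
  assumes \<tau>: "Re \<tau> = 0" "Im \<tau> > 0" and m: "m > 0"
  defines "\<tau>' \<equiv> - 4 / (of_nat m * \<tau>)"
  shows "y_param m \<tau> u =
    to_sphere (\<lambda>z. (theta4 z \<tau>' - theta1 z \<tau>') / (theta4 z \<tau>' + theta1 z \<tau>'))
      (2 * of_real pi / \<tau> * u + of_real pi / 2)"
proof -
  define \<sigma> where "\<sigma> = of_nat m * \<tau>"
  have \<sigma>: "Re \<sigma> = 0" "Im \<sigma> > 0" using \<tau> m by (simp_all add: \<sigma>_def)
  have ne: "\<tau> \<noteq> 0" "\<sigma> \<noteq> 0" using \<tau> \<sigma> by auto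
  have im: "Im \<tau>' > 0"
    using imag_axis_neg_inverse[OF \<sigma>, of 4] by (simp add: \<tau>'_def \<sigma>_def)
  note nz = theta3_nonzero[OF \<sigma>, of 0] theta2_0_nonzero[OF \<sigma>] theta4_0_nonzero[OF \<sigma>]
  let ?w = "\<lambda>u. of_real pi * of_nat m * u"
  let ?z = "\<lambda>u. 2 * of_real pi / \<tau> * u + of_real pi / 2"
  have "ellK \<sigma> \<noteq> 0" using nz by (simp add: ellK_def)
  then have w: "of_real pi * (2 * ellK \<sigma> * of_nat m * u) / (2 * ellK \<sigma>) = ?w u" for u
    by (simp add: field_simps)
  \<comment> \<open>Here \<open>m\<close> cancels, so the parametrisations for 1 and for
    \<open>n\<close> are evaluated at the same point.\<close>
  have z: "?z u = 2 * ?w u / \<sigma> + of_real pi / 2" for u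
    using ne m by (simp add: \<sigma>_def field_simps)
  have "eventually (\<lambda>u. theta4 (?w u) \<sigma> \<noteq> 0) (at u)"
    by (rule entire_eventually_nonzero[of _ 0]) (use \<sigma> nz in \<open>auto intro!: holomorphic_intros\<close>)
  then have "eventually (\<lambda>u. sqrt_k \<sigma> * jacobi_cd (2 * ellK \<sigma> * of_nat m * u) \<sigma> =
      (theta4 (?z u) \<tau>' - theta1 (?z u) \<tau>') / (theta4 (?z u) \<tau>' + theta1 (?z u) \<tau>')) (at u)"
  proof eventually_elim
    case (elim u)
    have "sqrt_k \<sigma> * jacobi_cd (2 * ellK \<sigma> * of_nat m * u) \<sigma> = theta2 (?w u) \<sigma> / theta3 (?w u) \<sigma>"
      unfolding jacobi_cd_def jacobi_cn_def jacobi_dn_def sqrt_k_def Let_def w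
      using nz elim by simp
    then show ?case
      using theta_quotient_half_argument[OF \<sigma>, of "?w u"] unfolding z[symmetric]
      by (simp add: \<tau>'_def \<sigma>_def)
  qed
  then have "y_param m \<tau> u = to_sphere (\<lambda>u. (theta4 (?z u) \<tau>' - theta1 (?z u) \<tau>') /
      (theta4 (?z u) \<tau>' + theta1 (?z u) \<tau>')) u"
    unfolding y_param_def \<sigma>_def by (rule to_sphere_cong)
  also have "\<dots> = to_sphere (\<lambda>z. (theta4 z \<tau>' - theta1 z \<tau>') / (theta4 z \<tau>' + theta1 z \<tau>')) (?z u)"
    by (rule to_sphere_affine) (use im ne in \<open>auto intro!: holomorphic_intros\<close>)
  finally show ?thesis .
qed

text \<open>The factor \<open>sqrt_k\<close> in \<open>l0\<close> undoes the theta constants in sn,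
  so \<open>l0\<close> acts as t -> (1 - t)/(1 + t) on t = theta1/theta4.\<close>

lemma l0_theta_quotient:
  assumes "Re \<tau> = 0" "Im \<tau> > 0" "\<tau> = - 4 / \<sigma>"
  shows "l0 \<sigma> (to_sphere (\<lambda>z. (theta3 0 \<tau> * theta1 z \<tau>) / (theta2 0 \<tau> * theta4 z \<tau>)) z) =
    to_sphere (\<lambda>z. (theta4 z \<tau> - theta1 z \<tau>) / (theta4 z \<tau> + theta1 z \<tau>)) z"
proof -
  define s where "s = sqrt_k \<tau>"
  let ?f = "\<lambda>z. (theta3 0 \<tau> * theta1 z \<tau>) / (theta2 0 \<tau> * theta4 z \<tau>)"
  let ?p = "- [:-1, s:]" and ?q = "[:1, s:]"
  note nz = theta3_nonzero[OF assms(1,2), of 0] theta2_0_nonzero[OF assms(1,2)]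
  \<comment> \<open>The two polynomials add up to the constant 2.\<close>
  have cop: "coprime ?p ?q"
  proof (rule coprimeI)
    fix d assume "d dvd ?p" "d dvd ?q"
    then have "d dvd ?p + ?q" by (rule dvd_add)
    also have "?p + ?q = [:2:]" by simp
    finally show "is_unit d"
      by (rule dvd_unit_imp_unit) (simp add: is_unit_const_poly_iff dvd_field_iff)
  qed
  have sf: "s * ?f z = theta1 z \<tau> / theta4 z \<tau>" for z
    using nz by (simp add: s_def sqrt_k_def)
  have ev4: "eventually (\<lambda>z. theta4 z \<tau> \<noteq> 0) (at z)"
    by (rule entire_eventually_nonzero[of _ "of_real pi / 2"])
      (use assms nz in \<open>auto intro!: holomorphic_intros simp: theta_half_pi\<close>)
  obtain b where "1 * theta1 b \<tau> + 1 * theta4 b \<tau> \<noteq> 0"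
    using independent_pairD[OF independent_pair_theta[OF assms(1,2)], of 1 1] by auto
  then have "eventually (\<lambda>z. theta1 z \<tau> + theta4 z \<tau> \<noteq> 0) (at z)"
    by (intro entire_eventually_nonzero[of _ b]) (use assms in \<open>auto intro!: holomorphic_intros\<close>)
  with ev4 have "eventually (\<lambda>z. poly ?q (?f z) \<noteq> 0) (at z)"
  proof eventually_elim
    case (elim z)
    have "poly ?q (?f z) = 1 + s * ?f z" by (simp add: mult.commute)
    also have "\<dots> = (theta1 z \<tau> + theta4 z \<tau>) / theta4 z \<tau>"
      unfolding sf using elim by (simp add: field_simps)
    finally show ?case using elim by simp
  qed
  moreover have "sphere_lim ?f z (to_sphere ?f z)"
    by (rule sphere_lim_quotient) (use assms in \<open>auto intro!: holomorphic_intros\<close>)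
  ultimately have lim: "sphere_lim (\<lambda>z. poly ?p (?f z) / poly ?q (?f z)) z (frac_map ?p ?q (to_sphere ?f z))"
    by (intro sphere_lim_frac_map[OF cop]) auto
  from ev4 have ev: "eventually (\<lambda>z. poly ?p (?f z) / poly ?q (?f z) =
      (theta4 z \<tau> - theta1 z \<tau>) / (theta4 z \<tau> + theta1 z \<tau>)) (at z)"
  proof eventually_elim
    case (elim z)
    have "poly ?p (?f z) / poly ?q (?f z) = (1 - s * ?f z) / (1 + s * ?f z)"
      by (simp add: mult.commute)
    also have "\<dots> = ((1 - s * ?f z) * theta4 z \<tau>) / ((1 + s * ?f z) * theta4 z \<tau>)"
      using elim by simp
    also have "\<dots> = (theta4 z \<tau> - theta1 z \<tau>) / (theta4 z \<tau> + theta1 z \<tau>)"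
      unfolding sf left_diff_distrib distrib_right using elim by simp
    finally show ?case .
  qed
  show ?thesis
    unfolding l0_def assms(3)[symmetric] s_def[symmetric]
    by (rule to_sphere_eqI[OF sphere_lim_cong[OF lim ev], symmetric])
qed

lemma linear_fractional_map_l0:
  assumes "Re \<sigma> = 0" "Im \<sigma> > 0"
  shows "linear_fractional_map (l0 \<sigma>)"
proof -
  define s where "s = sqrt_k (- 4 / \<sigma>)"
  have *: "Re (- 4 / \<sigma>) = 0" "Im (- 4 / \<sigma>) > 0"
    using imag_axis_neg_inverse[OF assms, of 4] by simp_all
  have "s \<noteq> 0"
    using theta3_nonzero[OF *, of 0] theta2_0_nonzero[OF *] by (simp add: s_def sqrt_k_def)
  then have "(- s) * 1 - 1 * s \<noteq> 0" by simp
  moreover have "l0 \<sigma> = frac_map [:1, - s:] [:1, s:]"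
    by (simp add: l0_def s_def)
  ultimately show ?thesis
    unfolding linear_fractional_map_def by blast
qed

section \<open>Comparison of the two fractions\<close>

theorem mainTheorem3:
  fixes n :: nat and \<tau> \<tau>\<^sub>1 :: complex
  assumes "n \<ge> 1"
    and "Re \<tau> = 0" and "Im \<tau> > 0"
    and "\<tau>\<^sub>1 = - 4 / (of_nat n * \<tau>)"
  shows "linear_fractional_map (l0 (of_nat n * \<tau>)) \<and> linear_fractional_map (l0 \<tau>) \<and>
    chebyshev_blaschke n \<tau> = l0 (of_nat n * \<tau>) \<circ> zolotarev_fraction n \<tau>\<^sub>1 \<circ> inv (l0 \<tau>)"
proof -
  define T where "T = of_nat n * \<tau>\<^sub>1"
  have n\<tau>: "Re (of_nat n * \<tau>) = 0" "Im (of_nat n * \<tau>) > 0"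
    using assms by simp_all
  have \<tau>1: "Re \<tau>\<^sub>1 = 0" "Im \<tau>\<^sub>1 > 0"
    unfolding assms(4) using imag_axis_neg_inverse[OF n\<tau>, of 4] by simp_all
  have T: "Re T = 0" "Im T > 0"
    using \<tau>1 assms(1) by (simp_all add: T_def)
  have T_eq: "T = - 4 / \<tau>"
    using assms(1) by (simp add: T_def assms(4))
  have "\<tau> \<noteq> 0" using assms(3) by auto

  \<comment> \<open>Capital letters belong to modulus \<open>T\<close>, small ones to
    \<open>\<tau>\<^sub>1\<close>; U/V is the sn side and A/B the cd side. Coefficients 0 and 1 are
    spelled out to match the two lemmas on linear combinations.\<close>
  define U V where "U = (\<lambda>z. theta3 0 T * theta1 z T + 0 * theta4 z T)"
    and "V = (\<lambda>z. 0 * theta1 z T + theta2 0 T * theta4 z T)"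
  define A B where "A = (\<lambda>z. (- 1) * theta1 z T + 1 * theta4 z T)"
    and "B = (\<lambda>z. 1 * theta1 z T + 1 * theta4 z T)"
  note ts = theta_in_theta_space[OF T(2), of 1, unfolded of_nat_1 mult_1]
  have space: "U \<in> theta_space T 1" "V \<in> theta_space T 1" "A \<in> theta_space T 1" "B \<in> theta_space T 1"
    unfolding U_def V_def A_def B_def by (rule theta_space_lincomb[OF ts])+
  note ind = independent_pair_lincomb[OF independent_pair_theta[OF T]]
  have UV: "independent_pair U V"
    unfolding U_def V_def
    by (rule ind) (use theta3_nonzero[OF T, of 0] theta2_0_nonzero[OF T] in simp)
  have AB: "independent_pair A B"
    unfolding A_def B_def by (rule ind) simp

  define u v where "u = (\<lambda>z. theta3 0 \<tau>\<^sub>1 * theta1 z \<tau>\<^sub>1 + 0 * theta4 z \<tau>\<^sub>1)"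
    and "v = (\<lambda>z. 0 * theta1 z \<tau>\<^sub>1 + theta2 0 \<tau>\<^sub>1 * theta4 z \<tau>\<^sub>1)"
  define a b where "a = (\<lambda>z. (- 1) * theta1 z \<tau>\<^sub>1 + 1 * theta4 z \<tau>\<^sub>1)"
    and "b = (\<lambda>z. 1 * theta1 z \<tau>\<^sub>1 + 1 * theta4 z \<tau>\<^sub>1)"
  have space1: "u \<in> theta_space T n" "v \<in> theta_space T n" "a \<in> theta_space T n" "b \<in> theta_space T n"
    unfolding u_def v_def a_def b_def T_def
    by (rule theta_space_lincomb[OF theta_in_theta_space[OF \<tau>1(2)]])+
  note ind1 = independent_pair_lincomb[OF independent_pair_theta[OF \<tau>1]]
  have uv: "independent_pair u v"
    unfolding u_def v_def
    by (rule ind1) (use theta3_nonzero[OF \<tau>1, of 0] theta2_0_nonzero[OF \<tau>1] in simp)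
  have ab: "independent_pair a b"
    unfolding a_def b_def by (rule ind1) simp
  obtain z1 where "0 * u z1 + 1 * v z1 \<noteq> 0"
    by (rule independent_pairD[OF uv, of 0 1]) simp
  then have z1: "v z1 \<noteq> 0" by simp
  obtain z2 where "0 * a z2 + 1 * b z2 \<noteq> 0"
    by (rule independent_pairD[OF ab, of 0 1]) simp
  then have z2: "b z2 \<noteq> 0" by simp

  have x: "x_param T t = to_sphere (\<lambda>z. U z / V z) (of_real pi / 2 * t)"
    "x_param \<tau>\<^sub>1 t = to_sphere (\<lambda>z. u z / v z) (of_real pi / 2 * t)" for t
    using x_param_eq[OF T] x_param_eq[OF \<tau>1] by (simp_all add: U_def V_def u_def v_def)
  have y: "y_param 1 \<tau> t = to_sphere (\<lambda>z. A z / B z) (2 * of_real pi / \<tau> * t + of_real pi / 2)"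
    "y_param n \<tau> t = to_sphere (\<lambda>z. a z / b z) (2 * of_real pi / \<tau> * t + of_real pi / 2)" for t
  proof -
    note y1 = y_param_eq[OF assms(2,3) zero_less_one, unfolded of_nat_1 mult_1, folded T_eq]
    have "n > 0" using assms(1) by simp
    note yn = y_param_eq[OF assms(2,3) this, folded assms(4)]
    show "y_param 1 \<tau> t = to_sphere (\<lambda>z. A z / B z) (2 * of_real pi / \<tau> * t + of_real pi / 2)"
      unfolding y1 A_def B_def by (simp add: add.commute)
    show "y_param n \<tau> t = to_sphere (\<lambda>z. a z / b z) (2 * of_real pi / \<tau> * t + of_real pi / 2)"
      unfolding yn a_def b_def by (simp add: add.commute)
  qed
  have l: "l0 \<tau> (to_sphere (\<lambda>z. U z / V z) z) = to_sphere (\<lambda>z. A z / B z) z"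
    "l0 (of_nat n * \<tau>) (to_sphere (\<lambda>z. u z / v z) z) = to_sphere (\<lambda>z. a z / b z) z" for z
    using l0_theta_quotient[OF T T_eq] l0_theta_quotient[OF \<tau>1 assms(4)]
    by (simp_all add: U_def V_def A_def B_def u_def v_def a_def b_def add.commute)

  have x_surj: "\<exists>t. x_param T t = w" for w
  proof -
    obtain z where "to_sphere (\<lambda>z. U z / V z) z = w"
      using theta_quotient_surj[OF T(2) space(1,2) UV] by blast
    then show ?thesis
      by (intro exI[of _ "2 / of_real pi * z"]) (simp add: x)
  qed
  have y_surj: "\<exists>t. y_param 1 \<tau> t = w" for w
  proof -
    obtain z where "to_sphere (\<lambda>z. A z / B z) z = w"
      using theta_quotient_surj[OF T(2) space(3,4) AB] by blast
    then show ?thesis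
      using \<open>\<tau> \<noteq> 0\<close> by (intro exI[of _ "\<tau> / (2 * of_real pi) * (z - of_real pi / 2)"]) (simp add: y del: One_nat_def)
  qed

  \<comment> \<open>Both maps are described in the theta argument \<open>z\<close>: the parameters
    of x and y are different affine functions of it, and only in \<open>z\<close> can the two
    equations be compared.\<close>
  obtain Z where Z: "rational_function Z"
    "\<And>z. Z (to_sphere (\<lambda>z. U z / V z) z) = to_sphere (\<lambda>z. u z / v z) z"
    using theta_quotient_rational[OF T(2) space(1,2) UV space1(1,2) z1] by blast
  obtain Y where Y: "rational_function Y"
    "\<And>z. Y (to_sphere (\<lambda>z. A z / B z) z) = to_sphere (\<lambda>z. a z / b z) z"
    using theta_quotient_rational[OF T(2) space(3,4) AB space1(3,4) z2] by blast
  have Zx: "Z (x_param T t) = x_param \<tau>\<^sub>1 t" for t by (simp only: x Z)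
  have Yy: "Y (y_param 1 \<tau> t) = y_param n \<tau> t" for t by (simp only: y Y)
  have "zolotarev_fraction n \<tau>\<^sub>1 = Z"
    unfolding zolotarev_fraction_def T_def[symmetric]
  proof (rule the_equality)
    fix Z' assume "rational_function Z' \<and> (\<forall>t. Z' (x_param T t) = x_param \<tau>\<^sub>1 t)"
    then show "Z' = Z" using Zx x_surj by (metis ext)
  qed (use Z Zx in blast)
  moreover have "chebyshev_blaschke n \<tau> = Y"
    unfolding chebyshev_blaschke_def
  proof (rule the_equality)
    fix Y' assume "rational_function Y' \<and> (\<forall>t. Y' (y_param 1 \<tau> t) = y_param n \<tau> t)"
    then show "Y' = Y" using Yy y_surj by (metis ext)
  qed (use Y Yy in blast)
  moreover have "Y w = l0 (of_nat n * \<tau>) (Z (inv (l0 \<tau>) w))" for w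
  proof -
    \<comment> \<open>A/B is onto and \<open>l\<close> exhibits its values as values of
      \<open>l0 \<tau>\<close>. A right inverse then suffices, because whatever preimage
      \<open>inv\<close> picks is again a value of U/V.\<close>
    have "surj (l0 \<tau>)"
      unfolding surj_def using l(1) y y_surj by metis
    then have w: "l0 \<tau> (inv (l0 \<tau>) w) = w" by (rule surj_f_inv_f)
    obtain z where z: "inv (l0 \<tau>) w = to_sphere (\<lambda>z. U z / V z) z"
      using x_surj[of "inv (l0 \<tau>) w"] unfolding x by metis
    then have "Y w = Y (to_sphere (\<lambda>z. A z / B z) z)"
      using w l(1) by metis
    also have "\<dots> = l0 (of_nat n * \<tau>) (Z (inv (l0 \<tau>) w))"
      unfolding z Y Z l ..
    finally show ?thesis .
  qed
  then have "Y = l0 (of_nat n * \<tau>) \<circ> Z \<circ> inv (l0 \<tau>)" by (simp add: fun_eq_iff)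
  ultimately show ?thesis
    using linear_fractional_map_l0[OF n\<tau>] linear_fractional_map_l0[OF assms(2,3)] by simp
qed

end
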